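(* Let $X$ be a metric space, let $\mu$ be a measure over $X$, let $\mathcal S\subset\mathcal P(X)$ be a nonempty class and let $\zeta:\mathcal S\to[0,+\infty]$ be a gauge. Fix $\tau>1$ and a nonempty set $A\subset X$, and assume: (1) $\mu$ is both a regular measure and a Borel measure. (2) Every element of $\mathcal S_{\mu,\zeta}$ is closed. (3) $\mathcal S_{\mu,\zeta}$ covers $A$ finely. (4) $A$ is a Borel set. (5) $A$ has a countable covering whose elements are open and have finite $\mu$-measure. (6) There exist $c\ge1$ and $\eta>0$ such that for every $S\in\mathcal S_{\mu,\zeta}$ there exists $\tilde S\in\mathcal S$ with $\hat S\subset\tilde S$, $\operatorname{diam}(\tilde S)\le c\,\operatorname{diam}(S)$ and $\zeta(\tilde S)\le\eta\,\zeta(S)$. (7) The subset $\{x\in A: F^\zeta(\mu,x)=0\}$ is $\sigma$-finite with respect to $\psi_\zeta$. (8) $\mu\llcorner A\ll\psi_\zeta\llcorner A$. If $F^\zeta(\mu,\cdot):A\to[0,+\infty]$ is Borel, then for every Borel set $B\subset A$ we have $$\mu(B)=\int_B F^\zeta(\mu,x)\,d\psi_\zeta(x).$$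
   Context: $X$ is a metric space with distance $d$. A "measure over $X$" is an outer measure defined on all subsets of $X$; measurability is in the sense of Carathéodory, and integrals are with respect to the restriction of the outer measure to its measurable sets. A measure $\mu$ over $X$ is regular if every $E\subset X$ is contained in a $\mu$-measurable set $E'$ with $\mu(E')=\mu(E)$; it is a Borel measure if all Borel sets are $\mu$-measurable. A set is $\sigma$-finite with respect to a measure over $X$ if it is covered by countably many sets of finite measure. $(\mu\llcorner A)(E)=\mu(A\cap E)$, and $\mu\llcorner A\ll\psi\llcorner A$ means that $\mu(N)=0$ for every $N\subset A$ with $\psi(N)=0$. A gauge is a function $\zeta:\mathcal S\to[0,+\infty]$ on a nonempty class $\mathcal S\subset\mathcal P(X)$. Convention: $\operatorname{diam}(\emptyset)=0$. Carathéodory measure: for $\delta>0$ and $R\subset X$, $\phi_{\zeta,\delta}(R)=\inf\sum_j\zeta(E_j)$, the infimum being over all countable (possibly finite) families $\{E_j\}\subset\mathcal S$ covering $R$ with $\operatorname{diam}(E_j)\le\delta$ for all $j$ ($\inf\emptyset=+\infty$); $\psi_\zeta(R)=\sup_{\delta>0}\phi_{\zeta,\delta}(R)$. A family $\mathcal G\subset\mathcal P(X)$ covers $A$ finely if for every $a\in A$ and $\epsilon>0$ there is $S\in\mathcal G$ with $a\in S$ and $\operatorname{diam}(S)<\epsilon$. $\mathcal S_{\mu,\zeta}=\mathcal S\setminus\{S\in\mathcal S:\ \zeta(S)=\mu(S)=0\ \text{or}\ \mu(S)=\zeta(S)=+\infty\}$. The quotient function $Q_{\mu,\zeta}:\mathcal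 S_{\mu,\zeta}\to[0,+\infty]$ is $Q_{\mu,\zeta}(S)=+\infty$ if $\zeta(S)=0$, $Q_{\mu,\zeta}(S)=\mu(S)/\zeta(S)$ if $0<\zeta(S)<+\infty$, and $Q_{\mu,\zeta}(S)=0$ if $\zeta(S)=+\infty$. If for every $\epsilon>0$ some $S\in\mathcal S_{\mu,\zeta}$ satisfies $x\in S$ and $\operatorname{diam}(S)<\epsilon$, the Federer density of $\mu$ at $x$ is $$F^\zeta(\mu,x)=\inf_{\epsilon>0}\sup\{Q_{\mu,\zeta}(S): S\in\mathcal S_{\mu,\zeta},\ x\in S,\ \operatorname{diam}(S)<\epsilon\}.$$ For the fixed $\tau>1$, the enlargement of $S$ is $\hat S=\bigcup\{T\in\mathcal S_{\mu,\zeta}: T\cap S\neq\emptyset,\ \operatorname{diam}(T)\le\tau\operatorname{diam}(S)\}$. *)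

theory Defs
  imports "HOL-Analysis.Analysis"
begin

text \<open>
  A metric space is a type of class \<^class>\<open>metric_space\<close>. A measure over it is a function
  \<^typ>\<open>'a set \<Rightarrow> ennreal\<close> satisfying \<^term>\<open>outer_measure_space UNIV\<close>. The library predicate
  \<^const>\<open>countably_subadditive\<close> only speaks about disjoint sequences; since an outer measure is
  also increasing and defined on all subsets, this gives subadditivity for arbitrary sequences.
\<close>

definition caratheodory_sets :: "('a set \<Rightarrow> ennreal) \<Rightarrow> 'a set set" where
  "caratheodory_sets \<phi> = lambda_system UNIV UNIV \<phi>"

definition caratheodory_restriction :: "('a set \<Rightarrow> ennreal) \<Rightarrow> 'a measure" where
  "caratheodory_restriction \<phi> = measure_of UNIV (caratheodory_sets \<phi>) \<phi>"

text \<open>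
  \<^const>\<open>measure_of\<close> yields the zero measure if its argument is not countably additive; the
  following facts exclude this for outer measures.
\<close>

lemma measure_space_caratheodory:
  assumes "outer_measure_space UNIV \<phi>"
  shows "measure_space UNIV (caratheodory_sets \<phi>) \<phi>"
proof -
  interpret sigma_algebra "UNIV :: 'a set" UNIV
    using sigma_algebra_Pow[of "UNIV :: 'a set"] by simp
  show ?thesis
    using caratheodory_lemma[OF assms] by (simp add: caratheodory_sets_def)
qed

lemma sets_caratheodory_restriction:
  assumes "outer_measure_space UNIV \<phi>"
  shows "sets (caratheodory_restriction \<phi>) = caratheodory_sets \<phi>"
  using measure_space_caratheodory[OF assms]
  unfolding caratheodory_restriction_def measure_space_def
  by (simp add: sigma_algebra.sigma_sets_eq)

lemma emeasure_caratheodory_restriction: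
  assumes "outer_measure_space UNIV \<phi>" and "E \<in> caratheodory_sets \<phi>"
  shows "emeasure (caratheodory_restriction \<phi>) E = \<phi> E"
  using measure_space_caratheodory[OF assms(1)] assms(2)
  unfolding caratheodory_restriction_def measure_space_def
  by (intro emeasure_measure_of_sigma) auto

definition regular_measure :: "('a set \<Rightarrow> ennreal) \<Rightarrow> bool" where
  "regular_measure \<phi> \<longleftrightarrow> (\<forall>E. \<exists>E'. E \<subseteq> E' \<and> E' \<in> caratheodory_sets \<phi> \<and> \<phi> E' = \<phi> E)"

definition borel_measure :: "('a::topological_space set \<Rightarrow> ennreal) \<Rightarrow> bool" where
  "borel_measure \<phi> \<longleftrightarrow> sets borel \<subseteq> caratheodory_sets \<phi>"

definition sigma_finite_wrt :: "('a set \<Rightarrow> ennreal) \<Rightarrow> 'a set \<Rightarrow> bool" where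
  "sigma_finite_wrt \<phi> E \<longleftrightarrow> (\<exists>C. countable C \<and> E \<subseteq> \<Union>C \<and> (\<forall>D\<in>C. \<phi> D < \<infinity>))"

definition abs_cont_on :: "'a set \<Rightarrow> ('a set \<Rightarrow> ennreal) \<Rightarrow> ('a set \<Rightarrow> ennreal) \<Rightarrow> bool" where
  "abs_cont_on A \<mu> \<psi> \<longleftrightarrow> (\<forall>N. N \<subseteq> A \<longrightarrow> \<psi> N = 0 \<longrightarrow> \<mu> N = 0)"

text \<open>
  The diameter takes values in \<open>[0,\<infinity>]\<close>, since the real-valued library constant
  \<^const>\<open>diameter\<close> is unspecified on unbounded sets. For the empty set the value is
  \<^term>\<open>bot :: ennreal\<close>, which is \<open>0\<close>.
\<close>

definition ediam :: "'a::metric_space set \<Rightarrow> ennreal" where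
  "ediam S = (SUP x\<in>S. SUP y\<in>S. ennreal (dist x y))"

definition covers_finely :: "'a::metric_space set set \<Rightarrow> 'a set \<Rightarrow> bool" where
  "covers_finely G A \<longleftrightarrow> (\<forall>a\<in>A. \<forall>\<epsilon>>0. \<exists>S\<in>G. a \<in> S \<and> ediam S < ennreal \<epsilon>)"

text \<open>
  A gauge on a class \<open>\<S>\<close> is a total function \<open>\<zeta>\<close>, of which only the values on \<open>\<S>\<close> are used.
  Countable, possibly finite, families are families indexed by a set \<open>J\<close> of natural numbers.
\<close>

definition caratheodory_premeasure ::
  "'a::metric_space set set \<Rightarrow> ('a set \<Rightarrow> ennreal) \<Rightarrow> real \<Rightarrow> 'a set \<Rightarrow> ennreal" where
  "caratheodory_premeasure \<S> \<zeta> \<delta> R =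
    Inf {(\<Sum>\<^sub>\<infinity>j\<in>J. \<zeta> (E j)) | (J :: nat set) E.
          (\<forall>j\<in>J. E j \<in> \<S> \<and> ediam (E j) \<le> ennreal \<delta>) \<and> R \<subseteq> (\<Union>j\<in>J. E j)}"

definition caratheodory_measure ::
  "'a::metric_space set set \<Rightarrow> ('a set \<Rightarrow> ennreal) \<Rightarrow> 'a set \<Rightarrow> ennreal" where
  "caratheodory_measure \<S> \<zeta> R = (SUP \<delta>\<in>{0<..}. caratheodory_premeasure \<S> \<zeta> \<delta> R)"

definition quotient_class ::
  "('a set \<Rightarrow> ennreal) \<Rightarrow> 'a set set \<Rightarrow> ('a set \<Rightarrow> ennreal) \<Rightarrow> 'a set set" where
  "quotient_class \<mu> \<S> \<zeta> =
    \<S> - {S \<in> \<S>. (\<zeta> S = 0 \<and> \<mu> S = 0) \<or> (\<mu> S = \<infinity> \<and> \<zeta> S = \<infinity>)}"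

definition quotient_function ::
  "('a set \<Rightarrow> ennreal) \<Rightarrow> ('a set \<Rightarrow> ennreal) \<Rightarrow> 'a set \<Rightarrow> ennreal" where
  "quotient_function \<mu> \<zeta> S =
    (if \<zeta> S = 0 then \<infinity> else if \<zeta> S = \<infinity> then 0 else \<mu> S / \<zeta> S)"

text \<open>
  The Federer density is only meaningful at points contained in sets of the quotient class of
  arbitrarily small diameter; at all other points the value below is \<open>0\<close>.
\<close>

definition federer_density ::
  "('a::metric_space set \<Rightarrow> ennreal) \<Rightarrow> 'a set set \<Rightarrow> ('a set \<Rightarrow> ennreal) \<Rightarrow> 'a \<Rightarrow> ennreal" where
  "federer_density \<mu> \<S> \<zeta> x =
    (INF \<epsilon>\<in>{0<..}. SUP S\<in>{S \<in> quotient_class \<mu> \<S> \<zeta>. x \<in> S \<and> ediam S < ennreal \<epsilon>}.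
        quotient_function \<mu> \<zeta> S)"

definition enlargement ::
  "real \<Rightarrow> ('a::metric_space set \<Rightarrow> ennreal) \<Rightarrow> 'a set set \<Rightarrow> ('a set \<Rightarrow> ennreal) \<Rightarrow> 'a set \<Rightarrow> 'a set" where
  "enlargement \<tau> \<mu> \<S> \<zeta> S =
    \<Union>{T \<in> quotient_class \<mu> \<S> \<zeta>. T \<inter> S \<noteq> {} \<and> ediam T \<le> ennreal \<tau> * ediam S}"

end

theory Submission
  imports Defs
begin

text \<open>
  Let \<open>\<psi>\<close> be the Caratheodory measure and \<open>F\<close> the Federer density. If \<open>F < t\<close> on \<open>B\<close>, then all small
  sets of the class meeting a large part of \<open>B\<close> satisfy \<open>\<mu> S \<le> t * \<zeta> S\<close>; exhausting \<open>B\<close>,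
  which is possible as \<open>\<mu>\<close> is regular, yields \<open>\<mu> B \<le> t * \<psi> B\<close>. If \<open>F > t\<close> on \<open>B\<close>, the sets \<open>S\<close> with \<open>\<mu> S > t * \<zeta> S\<close> cover
  \<open>B\<close> finely, and a Vitali argument gives \<open>t * \<psi> B \<le> \<mu> U\<close> for all open \<open>U\<close> containing \<open>B\<close>, hence
  \<open>t * \<psi> B \<le> \<mu> B\<close> by outer regularity. Consequently \<open>\<mu>\<close> and \<open>\<psi>\<close> with density \<open>F\<close> agree up to the factor
  \<open>t\<^sup>2\<close> on each level set \<open>t^n \<le> F < t^(n+1)\<close>. The set \<open>F = 0\<close> is \<open>\<mu>\<close>-null by \<open>\<sigma>\<close>-finiteness, and
  \<open>F = \<infinity>\<close> is \<open>\<psi>\<close>-null, hence \<open>\<mu>\<close>-null by absolute continuity. Finally \<open>t\<close> tends to \<open>1\<close>.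
\<close>

section \<open>Outer measures and Vitali selection\<close>

lemma suminf_tail_ennreal_tendsto_0:
  fixes g :: "nat \<Rightarrow> ennreal"
  assumes "suminf g < \<infinity>"
  shows "(\<lambda>n. \<Sum>i. g (i + n)) \<longlonglongrightarrow> 0"
proof -
  have "(\<Sum>i. g (i + n)) = suminf g - sum g {..<n}" for n
  proof -
    have "sum g {..<n} + (\<Sum>i. g (i + n)) = suminf g"
      using suminf_offset[of g n] by (simp add: add.commute)
    moreover have "sum g {..<n} < \<infinity>"
      by (rule le_less_trans[OF sum_le_suminf assms]) auto
    then have "sum g {..<n} + (\<Sum>i. g (i + n)) - sum g {..<n} = (\<Sum>i. g (i + n))"
      by (intro ennreal_add_diff_cancel_left) (simp only: infinity_ennreal_def less_top)
    ultimately show ?thesis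
      by (simp only:)
  qed
  moreover have "(\<lambda>n. suminf g - sum g {..<n}) \<longlonglongrightarrow> suminf g - suminf g"
    using assms by (intro tendsto_diff_ennreal tendsto_const summable_LIMSEQ) auto
  ultimately show ?thesis
    using assms by simp
qed

lemma ennreal_mult_le_iff_le_divide:
  assumes "0 < t"
  shows "ennreal t * y \<le> z \<longleftrightarrow> y \<le> z / ennreal t"
  using assms
  by (cases y; cases z)
    (auto simp: divide_ennreal ennreal_mult[symmetric] field_simps ennreal_mult_top top_unique
      ennreal_top_divide)

section \<open>Outer measures on arbitrary sets\<close>

lemma outer_measure_mono:
  assumes "outer_measure_space UNIV \<phi>" "R \<subseteq> T"
  shows "\<phi> R \<le> \<phi> T"
  using assms by (auto simp: outer_measure_space_def increasing_def)

lemma outer_measure_empty_set: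
  assumes "outer_measure_space UNIV \<phi>"
  shows "\<phi> {} = 0"
  using assms by (auto simp: outer_measure_space_def positive_def)

lemma outer_measure_UN_le:
  fixes R :: "nat \<Rightarrow> 'a set"
  assumes "outer_measure_space UNIV \<phi>"
  shows "\<phi> (\<Union>i. R i) \<le> (\<Sum>i. \<phi> (R i))"
proof -
  have "\<phi> (\<Union>i. disjointed R i) \<le> (\<Sum>i. \<phi> (disjointed R i))"
    using assms disjoint_family_disjointed[of R]
    unfolding outer_measure_space_def countably_subadditive_def by blast
  also have "\<dots> \<le> (\<Sum>i. \<phi> (R i))"
    using outer_measure_mono[OF assms disjointed_subset] by (intro suminf_le) auto
  finally show ?thesis
    by (simp add: UN_disjointed_eq)
qed

lemma outer_measure_Un_le:
  assumes "outer_measure_space UNIV \<phi>"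
  shows "\<phi> (R \<union> T) \<le> \<phi> R + \<phi> T"
proof -
  have "\<phi> (\<Union>i. binaryset R T i) \<le> (\<Sum>i. \<phi> (binaryset R T i))"
    by (rule outer_measure_UN_le[OF assms])
  then show ?thesis
    using suminf_binaryset_eq[of \<phi> R T] outer_measure_empty_set[OF assms]
    by (simp add: UN_binaryset_eq)
qed

lemma caratheodory_sets_iff:
  "C \<in> caratheodory_sets \<phi> \<longleftrightarrow> (\<forall>T. \<phi> (T \<inter> C) + \<phi> (T - C) = \<phi> T)"
proof -
  interpret sigma_algebra "UNIV :: 'a set" UNIV
    using sigma_algebra_Pow[of "UNIV :: 'a set"] by simp
  show ?thesis
    by (simp add: caratheodory_sets_def lambda_system_eq)
qed

lemma space_caratheodory_restriction [simp]: "space (caratheodory_restriction \<phi>) = UNIV"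
  by (simp add: caratheodory_restriction_def space_measure_of_conv)

text \<open>Regularity supplies measurable hulls \<open>H n\<close>, but these need not increase;
  their tail intersections \<open>G n\<close> do, still contain \<open>R n\<close>, and have no
  larger measure than \<open>H n\<close>. Continuity from below of a measure then applies. The point
  is that \<open>R n\<close> itself need not be measurable.\<close>

lemma regular_outer_measure_incseq:
  assumes om: "outer_measure_space UNIV \<phi>" and reg: "regular_measure \<phi>" and inc: "incseq R"
  shows "\<phi> (\<Union>n. R n) = (SUP n. \<phi> (R n))"
proof (rule antisym)
  let ?M = "caratheodory_restriction \<phi>"
  note sets = sets_caratheodory_restriction[OF om] and em = emeasure_caratheodory_restriction[OF om]
  have "\<forall>n. \<exists>E. R n \<subseteq> E \<and> E \<in> sets ?M \<and> \<phi> E = \<phi> (R n)"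
    using reg unfolding regular_measure_def sets by blast
  then obtain H where H: "\<And>n. R n \<subseteq> H n" "\<And>n. H n \<in> sets ?M" "\<And>n. \<phi> (H n) = \<phi> (R n)"
    unfolding choice_iff by blast
  define G where "G n = (\<Inter>m\<in>{n..}. H m)" for n
  have Gs: "G n \<in> sets ?M" for n
    unfolding G_def using H(2) sets.top[of ?M] by (intro sets.countable_INT'') auto
  have RG: "R n \<subseteq> G n" for n
    unfolding G_def using H(1) inc by (force dest: incseqD)
  have "\<phi> (\<Union>n. R n) \<le> \<phi> (\<Union>n. G n)"
    using RG by (intro outer_measure_mono[OF om]) blast
  also have "\<dots> = emeasure ?M (\<Union>n. G n)"
    using Gs by (intro em[symmetric]) (simp add: sets[symmetric])
  also have "\<dots> = (SUP n. emeasure ?M (G n))"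
    using Gs by (intro SUP_emeasure_incseq[symmetric]) (auto simp: incseq_def G_def)
  also have "\<dots> \<le> (SUP n. \<phi> (R n))"
  proof (intro SUP_mono bexI)
    fix n
    have "emeasure ?M (G n) = \<phi> (G n)"
      using Gs[of n] by (intro em) (simp add: sets[symmetric])
    also have "\<dots> \<le> \<phi> (H n)"
      by (intro outer_measure_mono[OF om]) (auto simp: G_def)
    finally show "emeasure ?M (G n) \<le> \<phi> (R n)"
      by (simp add: H(3))
  qed auto
  finally show "\<phi> (\<Union>n. R n) \<le> (SUP n. \<phi> (R n))" .
  show "(SUP n. \<phi> (R n)) \<le> \<phi> (\<Union>n. R n)"
    by (intro SUP_least outer_measure_mono[OF om]) auto
qed

text \<open>Zorn's lemma is applied to disjoint subfamilies that already dominate every member of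
  \<open>G\<close> they meet. A maximal such family meets every member: otherwise a nearly largest
  one among the missed members could be added. Countability is not part of the conclusion; it is
  obtained later from positive measure.\<close>

lemma vitali_subfamily:
  fixes d :: "'a set \<Rightarrow> ennreal"
  assumes ne: "\<And>S. S \<in> G \<Longrightarrow> S \<noteq> {}"
    and bound: "\<And>S. S \<in> G \<Longrightarrow> d S \<le> M" "M < \<infinity>" and \<tau>: "\<tau> > 1"
  obtains H where "H \<subseteq> G" "disjoint H"
    "\<And>S. S \<in> G \<Longrightarrow> \<exists>T\<in>H. T \<inter> S \<noteq> {} \<and> d S \<le> ennreal \<tau> * d T"
proof -
  define \<Omega> where "\<Omega> = {H. H \<subseteq> G \<and> disjoint H \<and>
    (\<forall>S\<in>G. S \<inter> \<Union>H \<noteq> {} \<longrightarrow> (\<exists>T\<in>H. T \<inter> S \<noteq> {} \<and> d S \<le> ennreal \<tau> * d T))}"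
  have H\<Omega>: "\<exists>T\<in>H. T \<inter> S \<noteq> {} \<and> d S \<le> ennreal \<tau> * d T"
    if "H \<in> \<Omega>" "S \<in> G" "S \<inter> \<Union>H \<noteq> {}" for H S
    using that unfolding \<Omega>_def mem_Collect_eq by meson
  have \<Omega>I: "H \<in> \<Omega>" if "H \<subseteq> G" "disjoint H"
      "\<And>S. S \<in> G \<Longrightarrow> S \<inter> \<Union>H \<noteq> {} \<Longrightarrow> \<exists>T\<in>H. T \<inter> S \<noteq> {} \<and> d S \<le> ennreal \<tau> * d T" for H
    using that unfolding \<Omega>_def mem_Collect_eq by meson
  have "\<exists>H\<in>\<Omega>. \<forall>H'\<in>\<Omega>. H \<subseteq> H' \<longrightarrow> H' = H"
  proof (rule subset_Zorn')
    fix C assume C: "subset.chain \<Omega> C"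
    then have sub: "C \<subseteq> \<Omega>" and lin: "\<And>H H'. H \<in> C \<Longrightarrow> H' \<in> C \<Longrightarrow> H \<subseteq> H' \<or> H' \<subseteq> H"
      by (auto simp: subset_chain_def)
    have "disjoint (\<Union>C)"
    proof (rule disjointI)
      fix S T assume "S \<in> \<Union>C" "T \<in> \<Union>C" and neq: "S \<noteq> T"
      then obtain H H' where "S \<in> H" "H \<in> C" "T \<in> H'" "H' \<in> C"
        by blast
      with lin[of H H'] obtain K where K: "K \<in> C" "S \<in> K" "T \<in> K"
        by blast
      with sub have "disjoint K"
        by (auto simp: \<Omega>_def)
      with K neq show "S \<inter> T = {}"
        by (meson disjointD)
    qed
    moreover have "\<exists>T\<in>\<Union>C. T \<inter> S \<noteq> {} \<and> d S \<le> ennreal \<tau> * d T"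
      if S: "S \<in> G" "S \<inter> \<Union>(\<Union>C) \<noteq> {}" for S
    proof -
      obtain H where H: "H \<in> C" "S \<inter> \<Union>H \<noteq> {}"
        using S(2) by blast
      then have "\<exists>T\<in>H. T \<inter> S \<noteq> {} \<and> d S \<le> ennreal \<tau> * d T"
        using H\<Omega>[of H] sub S(1) by blast
      with H(1) show ?thesis by blast
    qed
    moreover have "\<Union>C \<subseteq> G"
      using sub by (auto simp: \<Omega>_def)
    ultimately show "\<Union>C \<in> \<Omega>"
      by (intro \<Omega>I)
  qed
  then obtain H where H: "H \<in> \<Omega>" and max: "\<And>H'. H' \<in> \<Omega> \<Longrightarrow> H \<subseteq> H' \<Longrightarrow> H' = H"
    by blast
  have HG: "H \<subseteq> G" and disj: "disjoint H"
    using H by (auto simp: \<Omega>_def)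
  note old = H\<Omega>[OF H]
  have meets: "S \<inter> \<Union>H \<noteq> {}" if S: "S \<in> G" for S
  proof
    assume empty: "S \<inter> \<Union>H = {}"
    define K where "K = {S \<in> G. S \<inter> \<Union>H = {}}"
    define s where "s = (SUP S\<in>K. d S)"
    have SK: "S \<in> K"
      using S empty by (simp add: K_def)
    have "s \<le> M"
      unfolding s_def using bound(1) by (intro SUP_least) (auto simp: K_def)
    then have "s < \<infinity>"
      using bound(2) by (rule le_less_trans)
    \<comment> \<open>Since \<open>\<tau>\<close> exceeds 1, a positive supremum \<open>s\<close>
      lies above \<open>s / \<tau>\<close>, so some missed member exceeds that value; for
      \<open>s = 0\<close> every missed member works.\<close>
    have "\<exists>T\<in>K. s \<le> ennreal \<tau> * d T"
    proof (cases "s = 0")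
      case True
      with SK show ?thesis by auto
    next
      case False
      obtain r where r: "s = ennreal r" "r > 0"
        using False \<open>s < \<infinity>\<close> by (cases s) (auto simp: ennreal_eq_0_iff)
      have "ennreal (r / \<tau>) < s"
        unfolding r(1) using r(2) \<tau> by (intro ennreal_lessI) (auto simp: field_simps)
      then obtain T where T: "T \<in> K" "ennreal (r / \<tau>) < d T"
        unfolding s_def less_SUP_iff by blast
      have "s = ennreal \<tau> * ennreal (r / \<tau>)"
        using \<tau> r by (simp add: ennreal_mult[symmetric])
      also have "\<dots> \<le> ennreal \<tau> * d T"
        using T(2) by (intro mult_left_mono) auto
      finally show ?thesis
        using T(1) by blast
    qed
    then obtain T where T: "T \<in> K" "s \<le> ennreal \<tau> * d T"
      by blast
    have TH: "T \<inter> \<Union>H = {}" "T \<in> G"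
      using T(1) by (auto simp: K_def)
    \<comment> \<open>A member meeting \<open>insert T H\<close> but not \<open>H\<close> was
      missed, so its size is at most \<open>s\<close> and \<open>T\<close> dominates it; all others
      are dominated already in \<open>H\<close>.\<close>
    have "insert T H \<in> \<Omega>"
    proof -
      have "disjoint (insert T H)"
        using disj TH(1) by (auto simp: disjoint_def)
      moreover have "\<exists>T'\<in>insert T H. T' \<inter> S' \<noteq> {} \<and> d S' \<le> ennreal \<tau> * d T'"
        if S': "S' \<in> G" "S' \<inter> \<Union>(insert T H) \<noteq> {}" for S'
      proof (cases "S' \<inter> \<Union>H = {}")
        case True
        with S' have "S' \<in> K" "T \<inter> S' \<noteq> {}"
          by (auto simp: K_def)
        moreover from \<open>S' \<in> K\<close> have "d S' \<le> s"
          unfolding s_def by (rule SUP_upper)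
        ultimately show ?thesis
          using T(2) by (meson insertI1 order_trans)
      next
        case False
        with old[OF S'(1)] show ?thesis by blast
      qed
      ultimately show ?thesis
        using HG TH(2) by (intro \<Omega>I) auto
    qed
    \<comment> \<open>Maximality puts \<open>T\<close> into \<open>H\<close>, although
      \<open>T\<close> is nonempty and disjoint from the union of \<open>H\<close>.\<close>
    then have "insert T H = H"
      by (rule max) auto
    with TH ne[of T] show False by blast
  qed
  show ?thesis
  proof (rule that[OF HG disj])
    fix S assume "S \<in> G"
    then show "\<exists>T\<in>H. T \<inter> S \<noteq> {} \<and> d S \<le> ennreal \<tau> * d T"
      by (intro old meets)
  qed
qed

section \<open>The Caratheodory measure of a gauge\<close>

text \<open>Extending by zero outside \<open>J\<close> turns finite and infinite covers alike into
  ordinary series, the form used in the later estimates.\<close>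

lemma infsum_ennreal_eq_suminf:
  fixes f :: "nat \<Rightarrow> ennreal"
  shows "infsum f J = (\<Sum>j. if j \<in> J then f j else 0)"
proof -
  have "infsum f J = infsum (\<lambda>j. if j \<in> J then f j else 0) UNIV"
    by (rule infsum_cong_neutral) auto
  also have "\<dots> = (\<Sum>j. if j \<in> J then f j else 0)"
    by (intro sums_unique has_sum_imp_sums has_sum_infsum nonneg_summable_on_complete) auto
  finally show ?thesis .
qed

lemma dist_le_ediam:
  assumes "x \<in> S" "y \<in> S"
  shows "ennreal (dist x y) \<le> ediam S"
  unfolding ediam_def using assms by (meson SUP_upper2 order_refl)

section \<open>Premeasures at a fixed scale\<close>

lemma caratheodory_premeasure_le:
  fixes E :: "nat \<Rightarrow> 'a::metric_space set"
  assumes "\<And>j. j \<in> J \<Longrightarrow> E j \<in> \<S>" "\<And>j. j \<in> J \<Longrightarrow> ediam (E j) \<le> ennreal \<delta>" "R \<subseteq> (\<Union>j\<in>J. E j)"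
  shows "caratheodory_premeasure \<S> \<zeta> \<delta> R \<le> (\<Sum>j. if j \<in> J then \<zeta> (E j) else 0)"
  unfolding caratheodory_premeasure_def infsum_ennreal_eq_suminf
  using assms by (intro Inf_lower CollectI exI[of _ J] exI[of _ E]) auto

lemma caratheodory_premeasure_greatest:
  fixes R :: "'a::metric_space set"
  assumes "\<And>J E. (\<And>j. j \<in> J \<Longrightarrow> E j \<in> \<S>) \<Longrightarrow> (\<And>j. j \<in> J \<Longrightarrow> ediam (E j) \<le> ennreal \<delta>) \<Longrightarrow>
      R \<subseteq> (\<Union>j\<in>J. E j) \<Longrightarrow> b \<le> (\<Sum>j. if j \<in> (J :: nat set) then \<zeta> (E j) else 0)"
  shows "b \<le> caratheodory_premeasure \<S> \<zeta> \<delta> R"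
  unfolding caratheodory_premeasure_def infsum_ennreal_eq_suminf
  using assms by (intro Inf_greatest) blast

lemma caratheodory_premeasure_lessE:
  fixes R :: "'a::metric_space set"
  assumes "caratheodory_premeasure \<S> \<zeta> \<delta> R < b"
  obtains J E where "\<And>j. j \<in> J \<Longrightarrow> E j \<in> \<S>" "\<And>j. j \<in> J \<Longrightarrow> ediam (E j) \<le> ennreal \<delta>"
    "R \<subseteq> (\<Union>j\<in>J. E j)" "(\<Sum>j. if j \<in> (J :: nat set) then \<zeta> (E j) else 0) < b"
  using assms unfolding caratheodory_premeasure_def infsum_ennreal_eq_suminf Inf_less_iff by blast

lemma caratheodory_premeasure_antimono:
  assumes "\<delta> \<le> \<delta>'"
  shows "caratheodory_premeasure \<S> \<zeta> \<delta>' R \<le> caratheodory_premeasure \<S> \<zeta> \<delta> R"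
  using assms
  by (intro caratheodory_premeasure_greatest caratheodory_premeasure_le)
    (auto intro: order_trans[OF _ ennreal_leI])

lemma caratheodory_premeasure_le_measure:
  assumes "0 < \<delta>"
  shows "caratheodory_premeasure \<S> \<zeta> \<delta> R \<le> caratheodory_measure \<S> \<zeta> R"
  unfolding caratheodory_measure_def using assms by (intro SUP_upper) auto

text \<open>Premeasures grow as the scale shrinks, so scales below \<open>r\<close> determine the
  supremum; \<open>r/2\<close> in the proof keeps the comparison scale strictly below
  \<open>r\<close>.\<close>

lemma caratheodory_measure_leI:
  assumes "0 < r" "\<And>\<delta>. 0 < \<delta> \<Longrightarrow> \<delta> < r \<Longrightarrow> caratheodory_premeasure \<S> \<zeta> \<delta> R \<le> b"
  shows "caratheodory_measure \<S> \<zeta> R \<le> b"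
  unfolding caratheodory_measure_def
proof (rule SUP_least)
  fix \<delta> :: real assume "\<delta> \<in> {0<..}"
  then have "caratheodory_premeasure \<S> \<zeta> \<delta> R \<le> caratheodory_premeasure \<S> \<zeta> (min \<delta> (r/2)) R"
    by (intro caratheodory_premeasure_antimono) auto
  also have "\<dots> \<le> b"
    using \<open>\<delta> \<in> _\<close> assms(1) by (intro assms(2)) auto
  finally show "caratheodory_premeasure \<S> \<zeta> \<delta> R \<le> b" .
qed

lemma caratheodory_premeasure_mono:
  assumes "R \<subseteq> T"
  shows "caratheodory_premeasure \<S> \<zeta> \<delta> R \<le> caratheodory_premeasure \<S> \<zeta> \<delta> T"
  using assms by (intro caratheodory_premeasure_greatest caratheodory_premeasure_le) auto

text \<open>Covers of the \<open>R i\<close>, each optimal up to \<open>e / 2^(i+1)\<close>, are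
  merged into one cover by the pairing of natural numbers; the errors add up to
  \<open>e\<close>.\<close>

lemma caratheodory_premeasure_UN_le:
  fixes R :: "nat \<Rightarrow> 'a::metric_space set"
  shows "caratheodory_premeasure \<S> \<zeta> \<delta> (\<Union>i. R i) \<le> (\<Sum>i. caratheodory_premeasure \<S> \<zeta> \<delta> (R i))"
proof (rule ennreal_le_epsilon)
  let ?p = "caratheodory_premeasure \<S> \<zeta> \<delta>"
  fix e :: real assume e: "0 < e" and fin: "(\<Sum>i. ?p (R i)) < top"
  \<comment> \<open>Index set and sets form a pair, so that one application of choice selects the
    cover of every \<open>R i\<close>.\<close>
  define good where "good i p \<longleftrightarrow> (\<forall>j\<in>fst p. snd p j \<in> \<S> \<and> ediam (snd p j) \<le> ennreal \<delta>) \<and>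
      R i \<subseteq> (\<Union>j\<in>fst p. snd p j) \<and>
      (\<Sum>j. if j \<in> fst p then \<zeta> (snd p j) else 0) < ?p (R i) + ennreal (e * (1/2) ^ Suc i)"
    for i and p :: "nat set \<times> (nat \<Rightarrow> 'a set)"
  have "\<exists>p. good i p" for i
  proof -
    have "?p (R i) < top"
      using fin by (rule ennreal_suminf_lessD)
    then have "?p (R i) < ?p (R i) + ennreal (e * (1/2) ^ Suc i)"
      using e by (cases "?p (R i)") (auto simp: ennreal_plus[symmetric] ennreal_less_iff simp del: ennreal_plus)
    then obtain J E where "\<And>j. j \<in> J \<Longrightarrow> E j \<in> \<S>" "\<And>j. j \<in> J \<Longrightarrow> ediam (E j) \<le> ennreal \<delta>"
      "R i \<subseteq> (\<Union>j\<in>J. E j)"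
      "(\<Sum>j. if j \<in> (J :: nat set) then \<zeta> (E j) else 0) < ?p (R i) + ennreal (e * (1/2) ^ Suc i)"
      by (rule caratheodory_premeasure_lessE) blast
    then have "good i (J, E)"
      unfolding good_def fst_conv snd_conv by auto
    then show ?thesis ..
  qed
  then obtain p where p: "\<And>i. good i (p i)"
    by metis
  define J where "J i = fst (p i)" for i
  define E where "E i = snd (p i)" for i
  have JE: "\<And>i j. j \<in> J i \<Longrightarrow> E i j \<in> \<S>" "\<And>i j. j \<in> J i \<Longrightarrow> ediam (E i j) \<le> ennreal \<delta>"
      "\<And>i. R i \<subseteq> (\<Union>j\<in>J i. E i j)"
      "\<And>i. (\<Sum>j. if j \<in> J i then \<zeta> (E i j) else 0) < ?p (R i) + ennreal (e * (1/2) ^ Suc i)"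
    using p unfolding good_def J_def E_def by auto
  define K where "K = {k. snd (prod_decode k) \<in> J (fst (prod_decode k))}"
  define D where "D k = E (fst (prod_decode k)) (snd (prod_decode k))" for k
  have "?p (\<Union>i. R i) \<le> (\<Sum>k. if k \<in> K then \<zeta> (D k) else 0)"
  proof (rule caratheodory_premeasure_le)
    show "(\<Union>i. R i) \<subseteq> (\<Union>k\<in>K. D k)"
    proof
      fix x assume "x \<in> (\<Union>i. R i)"
      then obtain i j where "j \<in> J i" "x \<in> E i j"
        using JE(3) by blast
      then show "x \<in> (\<Union>k\<in>K. D k)"
        by (intro UN_I[of "prod_encode (i, j)"]) (auto simp: K_def D_def)
    qed
  qed (auto simp: K_def D_def JE)
  also have "\<dots> = (\<Sum>k. (\<lambda>(i, j). if j \<in> J i then \<zeta> (E i j) else 0) (prod_decode k))"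
    by (intro suminf_cong) (simp add: K_def D_def split_beta)
  also have "\<dots> = (\<Sum>i. \<Sum>j. if j \<in> J i then \<zeta> (E i j) else 0)"
    by (rule suminf_ennreal_2dimen) simp
  also have "\<dots> \<le> (\<Sum>i. ?p (R i) + ennreal (e * (1/2) ^ Suc i))"
    using JE(4) by (intro suminf_le) (auto intro: less_imp_le)
  also have "\<dots> = (\<Sum>i. ?p (R i)) + (\<Sum>i. ennreal (e * (1/2) ^ Suc i))"
    by (rule suminf_add[symmetric]) auto
  also have "(\<Sum>i. ennreal (e * (1/2) ^ Suc i)) = ennreal e"
    using sums_mult[OF power_half_series, of e] e by (intro suminf_ennreal_eq) auto
  finally show "?p (\<Union>i. R i) \<le> (\<Sum>i. ?p (R i)) + ennreal e" .
qed

section \<open>The outer measure and measurability of Borel sets\<close>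

lemma outer_measure_space_caratheodory_measure:
  "outer_measure_space UNIV (caratheodory_measure \<S> \<zeta>)"
proof -
  let ?p = "caratheodory_premeasure \<S> \<zeta>" and ?\<psi> = "caratheodory_measure \<S> \<zeta>"
  have "?\<psi> {} \<le> 0"
  proof (rule caratheodory_measure_leI[of 1])
    \<comment> \<open>The empty index set covers the empty set at cost 0, whether or not the empty
      set belongs to \<open>\<S>\<close>.\<close>
    show "?p \<delta> {} \<le> 0" for \<delta>
      using caratheodory_premeasure_le[of "{}" "\<lambda>_. {}" \<S> \<delta> "{}" \<zeta>] by simp
  qed simp
  moreover have "?\<psi> R \<le> ?\<psi> T" if "R \<subseteq> T" for R T
    unfolding caratheodory_measure_def
    by (intro SUP_mono) (use caratheodory_premeasure_mono[OF that] in blast)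
  moreover have "?\<psi> (\<Union>i. R i) \<le> (\<Sum>i. ?\<psi> (R i))" for R :: "nat \<Rightarrow> 'a set"
  proof (rule caratheodory_measure_leI[of 1])
    fix \<delta> :: real assume "0 < \<delta>"
    have "?p \<delta> (\<Union>i. R i) \<le> (\<Sum>i. ?p \<delta> (R i))"
      by (rule caratheodory_premeasure_UN_le)
    also have "\<dots> \<le> (\<Sum>i. ?\<psi> (R i))"
      by (intro suminf_le caratheodory_premeasure_le_measure \<open>0 < \<delta>\<close>) auto
    finally show "?p \<delta> (\<Union>i. R i) \<le> (\<Sum>i. ?\<psi> (R i))" .
  qed simp
  ultimately show ?thesis
    by (auto simp: outer_measure_space_def positive_def increasing_def countably_subadditive_def)
qed

text \<open>At scales below \<open>r\<close> no set of a cover meets both \<open>R\<close> and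
  \<open>T\<close>, so the members meeting \<open>R\<close> and those meeting \<open>T\<close> form
  disjoint subfamilies of every cover of the union.\<close>

lemma caratheodory_measure_separated:
  fixes R T :: "'a::metric_space set"
  assumes r: "0 < r" and sep: "\<And>x y. x \<in> R \<Longrightarrow> y \<in> T \<Longrightarrow> r \<le> dist x y"
  shows "caratheodory_measure \<S> \<zeta> R + caratheodory_measure \<S> \<zeta> T \<le> caratheodory_measure \<S> \<zeta> (R \<union> T)"
proof -
  let ?p = "caratheodory_premeasure \<S> \<zeta>" and ?\<psi> = "caratheodory_measure \<S> \<zeta>"
  have split: "?p \<delta> R + ?p \<delta> T \<le> ?\<psi> (R \<union> T)" if \<delta>: "0 < \<delta>" "\<delta> < r" for \<delta>
  proof -
    have "?p \<delta> R + ?p \<delta> T \<le> ?p \<delta> (R \<union> T)"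
    proof (rule caratheodory_premeasure_greatest)
      fix J :: "nat set" and E
      assume E: "\<And>j. j \<in> J \<Longrightarrow> E j \<in> \<S>" "\<And>j. j \<in> J \<Longrightarrow> ediam (E j) \<le> ennreal \<delta>"
        "R \<union> T \<subseteq> (\<Union>j\<in>J. E j)"
      define I where "I Q = {j \<in> J. E j \<inter> Q \<noteq> {}}" for Q
      have p: "?p \<delta> Q \<le> (\<Sum>j. if j \<in> I Q then \<zeta> (E j) else 0)" if Q: "Q \<subseteq> R \<union> T" for Q
      proof (rule caratheodory_premeasure_le)
        show "Q \<subseteq> (\<Union>j\<in>I Q. E j)"
        proof
          fix x assume "x \<in> Q"
          moreover from this obtain j where "j \<in> J" "x \<in> E j"
            using E(3) Q by blast
          ultimately show "x \<in> (\<Union>j\<in>I Q. E j)"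
            by (auto simp: I_def)
        qed
      qed (use E in \<open>auto simp: I_def\<close>)
      have disj: "j \<notin> I R \<or> j \<notin> I T" for j
      proof (rule ccontr)
        assume "\<not> ?thesis"
        then obtain x y where xy: "x \<in> R" "y \<in> T" "x \<in> E j" "y \<in> E j" "j \<in> J"
          by (auto simp: I_def)
        have "ennreal (dist x y) \<le> ennreal \<delta>"
          using dist_le_ediam[OF xy(3,4)] E(2)[OF xy(5)] by (rule order_trans)
        with sep[OF xy(1,2)] \<delta> show False by simp
      qed
      have "?p \<delta> R + ?p \<delta> T \<le> (\<Sum>j. if j \<in> I R then \<zeta> (E j) else 0) + (\<Sum>j. if j \<in> I T then \<zeta> (E j) else 0)"
        by (intro add_mono p) auto
      also have "\<dots> = (\<Sum>j. (if j \<in> I R then \<zeta> (E j) else 0) + (if j \<in> I T then \<zeta> (E j) else 0))"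
        by (rule suminf_add) auto
      also have "\<dots> \<le> (\<Sum>j. if j \<in> J then \<zeta> (E j) else 0)"
      proof (intro suminf_le)
        show "(if j \<in> I R then \<zeta> (E j) else 0) + (if j \<in> I T then \<zeta> (E j) else 0)
          \<le> (if j \<in> J then \<zeta> (E j) else 0)" for j
          using disj[of j] by (auto simp: I_def)
      qed auto
      finally show "?p \<delta> R + ?p \<delta> T \<le> (\<Sum>j. if j \<in> J then \<zeta> (E j) else 0)" .
    qed
    also have "\<dots> \<le> ?\<psi> (R \<union> T)"
      by (rule caratheodory_premeasure_le_measure[OF \<delta>(1)])
    finally show ?thesis .
  qed
  have "?\<psi> R + ?\<psi> T = (SUP \<delta>\<in>{0<..}. ?p \<delta> R + ?\<psi> T)"
    unfolding caratheodory_measure_def[of _ _ R] by (intro ennreal_SUP_add_left[symmetric]) auto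
  also have "\<dots> \<le> ?\<psi> (R \<union> T)"
  proof (rule SUP_least)
    fix \<delta> :: real assume \<delta>: "\<delta> \<in> {0<..}"
    have "?p \<delta> R + ?\<psi> T = (SUP \<epsilon>\<in>{0<..}. ?p \<delta> R + ?p \<epsilon> T)"
      unfolding caratheodory_measure_def[of _ _ T] by (intro ennreal_SUP_add_right) auto
    also have "\<dots> \<le> ?\<psi> (R \<union> T)"
    proof (rule SUP_least)
      fix \<epsilon> :: real assume \<epsilon>: "\<epsilon> \<in> {0<..}"
      \<comment> \<open>Passing to a common scale below \<open>r\<close> can only increase both
        premeasures; hence the two suprema may be taken independently.\<close>
      define m where "m = min (min \<delta> \<epsilon>) (r/2)"
      have "?p \<delta> R + ?p \<epsilon> T \<le> ?p m R + ?p m T"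
        by (intro add_mono caratheodory_premeasure_antimono) (auto simp: m_def)
      also have "\<dots> \<le> ?\<psi> (R \<union> T)"
        using \<delta> \<epsilon> r by (intro split) (auto simp: m_def)
      finally show "?p \<delta> R + ?p \<epsilon> T \<le> ?\<psi> (R \<union> T)" .
    qed
    finally show "?p \<delta> R + ?\<psi> T \<le> ?\<psi> (R \<union> T)" .
  qed
  finally show ?thesis .
qed

text \<open>Pieces are split off one at a time, the remaining ones being kept as a single union. The
  gap may shrink with \<open>i\<close>, as each step uses only the separation of one piece from all
  later ones.\<close>

lemma sum_separated_le:
  fixes \<phi> :: "'a::metric_space set \<Rightarrow> ennreal" and P :: "nat \<Rightarrow> 'a set"
  assumes metric: "\<And>R T r. 0 < r \<Longrightarrow> (\<And>x y. x \<in> R \<Longrightarrow> y \<in> T \<Longrightarrow> r \<le> dist x y) \<Longrightarrow>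
      \<phi> R + \<phi> T \<le> \<phi> (R \<union> T)"
    and sep: "\<And>i. \<exists>r>0. \<forall>j>i. \<forall>x\<in>P i. \<forall>y\<in>P j. r \<le> dist x y"
  shows "(\<Sum>i. \<phi> (P i)) \<le> \<phi> (\<Union>i. P i)"
proof (rule suminf_le_const)
  fix n
  have "(\<Sum>i<n. \<phi> (P i)) + \<phi> (\<Union>j\<in>{n..}. P j) \<le> \<phi> (\<Union>i. P i)"
  proof (induction n)
    case (Suc n)
    obtain r where r: "r > 0" "\<forall>j>n. \<forall>x\<in>P n. \<forall>y\<in>P j. r \<le> dist x y"
      using sep by blast
    have "\<phi> (P n) + \<phi> (\<Union>j\<in>{Suc n..}. P j) \<le> \<phi> (P n \<union> (\<Union>j\<in>{Suc n..}. P j))"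
      using r(2) by (intro metric[OF r(1)]) (auto simp: Suc_le_eq)
    also have "P n \<union> (\<Union>j\<in>{Suc n..}. P j) = (\<Union>j\<in>{n..}. P j)"
      by (force simp: Suc_le_eq le_less)
    finally have "(\<Sum>i<n. \<phi> (P i)) + (\<phi> (P n) + \<phi> (\<Union>j\<in>{Suc n..}. P j)) \<le>
        (\<Sum>i<n. \<phi> (P i)) + \<phi> (\<Union>j\<in>{n..}. P j)"
      by (rule add_left_mono)
    from order_trans[OF this Suc] show ?case
      by (simp add: add.assoc)
  qed simp
  moreover have "(\<Sum>i<n. \<phi> (P i)) \<le> (\<Sum>i<n. \<phi> (P i)) + \<phi> (\<Union>j\<in>{n..}. P j)"
    by simp
  ultimately show "(\<Sum>i<n. \<phi> (P i)) \<le> \<phi> (\<Union>i. P i)"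
    by (rule order_trans[rotated])
qed auto

text \<open>
  The part of \<open>T\<close> off \<open>C\<close> is cut into rings by the distance to \<open>C\<close>. Rings that are not adjacent
  are separated, so the measures of the even and of the odd ones are summable.
\<close>

lemma metric_outer_measure_closed:
  fixes \<phi> :: "'a::metric_space set \<Rightarrow> ennreal"
  assumes om: "outer_measure_space UNIV \<phi>"
    and metric: "\<And>R T r. 0 < r \<Longrightarrow> (\<And>x y. x \<in> R \<Longrightarrow> y \<in> T \<Longrightarrow> r \<le> dist x y) \<Longrightarrow>
      \<phi> R + \<phi> T \<le> \<phi> (R \<union> T)"
    and C: "closed C"
  shows "C \<in> caratheodory_sets \<phi>"
proof (cases "C = {}")
  case True
  then show ?thesis
    by (simp add: caratheodory_sets_iff outer_measure_empty_set[OF om])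
next
  case ne: False
  \<comment> \<open>Only test sets of finite measure matter; finiteness makes the series over the
    rings converge, so that its tails vanish.\<close>
  have "\<phi> (T \<inter> C) + \<phi> (T - C) \<le> \<phi> T" if fin: "\<phi> T < \<infinity>" for T
  proof -
    define f where "f x = infdist x C" for x
    have f_lip: "f x - f y \<le> dist x y" for x y
      using infdist_triangle_abs[of x C y] by (auto simp: f_def)
    have f_pos: "f x > 0" if "x \<notin> C" for x
      using that C ne unfolding f_def by (metis in_closed_iff_infdist_zero infdist_nonneg order_le_less)
    define a where "a n = 1 / real (Suc n)" for n
    have a_pos: "a n > 0" and a_dec: "i < j \<Longrightarrow> a j < a i" for n i j
      by (auto simp: a_def field_simps)
    have a_mono: "i \<le> j \<Longrightarrow> a j \<le> a i" for i j
      by (auto simp: a_def field_simps)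
    define Q where "Q n = {x \<in> T. a n \<le> f x}" for n
    define R where "R n = {x \<in> T. a (Suc n) \<le> f x \<and> f x < a n}" for n
    have parity: "(\<Sum>i. \<phi> (R (2 * i + k))) \<le> \<phi> T" for k
    proof -
      have "(\<Sum>i. \<phi> (R (2 * i + k))) \<le> \<phi> (\<Union>i. R (2 * i + k))"
      proof (intro sum_separated_le[OF metric])
        fix i
        \<comment> \<open>On ring \<open>2 * i + k\<close> the distance to \<open>C\<close> is at
          least \<open>a (Suc (2 * i + k))\<close>, on a later ring of the same parity it is below
          \<open>a (2 * i + k + 2)\<close>; \<open>f_lip\<close> turns the difference into a
          gap.\<close>
        let ?r = "a (Suc (2 * i + k)) - a (2 * i + k + 2)"
        have "?r \<le> dist x y" if "j > i" "x \<in> R (2 * i + k)" "y \<in> R (2 * j + k)" for j x y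
        proof -
          have "a (2 * j + k) \<le> a (2 * i + k + 2)"
            using that(1) by (intro a_mono) auto
          with that(2,3) f_lip[of x y] show ?thesis
            by (auto simp: R_def)
        qed
        moreover have "?r > 0"
          using a_dec[of "Suc (2 * i + k)" "2 * i + k + 2"] by simp
        ultimately show "\<exists>r>0. \<forall>j>i. \<forall>x\<in>R (2 * i + k). \<forall>y\<in>R (2 * j + k). r \<le> dist x y"
          by blast
      qed auto
      also have "\<dots> \<le> \<phi> T"
        by (intro outer_measure_mono[OF om]) (auto simp: R_def)
      finally show ?thesis .
    qed
    define g where "g i = \<phi> (R i)" for i
    have "(\<Sum>i<n. g i) \<le> \<phi> T + \<phi> T" for n
    proof -
      have "(\<Sum>i<n. g i) \<le> (\<Sum>i<2*n. g i)"
        by (intro sum_mono2) auto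
      also have "\<dots> = (\<Sum>i<n. g (2 * i + 0)) + (\<Sum>i<n. g (2 * i + 1))"
        by (induction n) (auto simp: algebra_simps)
      also have "\<dots> \<le> (\<Sum>i. g (2 * i + 0)) + (\<Sum>i. g (2 * i + 1))"
        by (intro add_mono sum_le_suminf) auto
      also have "\<dots> \<le> \<phi> T + \<phi> T"
        unfolding g_def by (intro add_mono parity)
      finally show ?thesis .
    qed
    then have "suminf g \<le> \<phi> T + \<phi> T"
      by (intro suminf_le_const) auto
    also have "\<dots> < \<infinity>"
      using fin by simp
    finally have g_fin: "suminf g < \<infinity>" .
    have tail: "\<phi> (T - C) \<le> \<phi> (Q n) + (\<Sum>i. g (i + n))" for n
    proof -
      have "T - C \<subseteq> Q n \<union> (\<Union>i. R (i + n))"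
      proof
        fix x assume x: "x \<in> T - C"
        obtain m where m: "a m < f x"
          using f_pos[of x] x reals_Archimedean[of "f x"] by (auto simp: a_def inverse_eq_divide)
        show "x \<in> Q n \<union> (\<Union>i. R (i + n))"
        proof (cases "a n \<le> f x")
          case False
          \<comment> \<open>The first threshold not above \<open>f x\<close> has index beyond
            \<open>n\<close>; its predecessor exceeds \<open>f x\<close>, so \<open>x\<close> lies
            in the ring with index \<open>l - 1\<close>.\<close>
          define l where "l = (LEAST l. a l \<le> f x)"
          have l: "a l \<le> f x"
            unfolding l_def using m by (intro LeastI[of "\<lambda>l. a l \<le> f x" m]) simp
          have "l > n"
            using l False a_mono[of l n] by (cases "l \<le> n") auto
          then obtain i where i: "l = Suc (i + n)"
            by (metis add.commute less_imp_Suc_add)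
          have "\<not> a (i + n) \<le> f x"
            using not_less_Least[of "i + n" "\<lambda>l. a l \<le> f x"] i by (simp add: l_def)
          with l i x show ?thesis
            by (auto simp: R_def)
        qed (use x in \<open>simp add: Q_def\<close>)
      qed
      then have "\<phi> (T - C) \<le> \<phi> (Q n \<union> (\<Union>i. R (i + n)))"
        by (rule outer_measure_mono[OF om])
      also have "\<dots> \<le> \<phi> (Q n) + \<phi> (\<Union>i. R (i + n))"
        by (rule outer_measure_Un_le[OF om])
      also have "\<dots> \<le> \<phi> (Q n) + (\<Sum>i. g (i + n))"
        unfolding g_def by (rule add_left_mono[OF outer_measure_UN_le[OF om]])
      finally show ?thesis .
    qed
    have "\<phi> (T \<inter> C) + \<phi> (T - C) \<le> \<phi> T + (\<Sum>i. g (i + n))" for n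
    proof -
      \<comment> \<open>\<open>f\<close> vanishes on \<open>C\<close> and is at least
        \<open>a n\<close> on \<open>Q n\<close>, so these parts are separated; what is lost between
        them is bounded by the tail, which tends to 0.\<close>
      have "\<phi> (T \<inter> C) + \<phi> (Q n) \<le> \<phi> ((T \<inter> C) \<union> Q n)"
      proof (rule metric[OF a_pos[of n]])
        fix x y assume "x \<in> T \<inter> C" "y \<in> Q n"
        then show "a n \<le> dist x y"
          using f_lip[of y x] by (auto simp: Q_def f_def dist_commute)
      qed
      also have "\<dots> \<le> \<phi> T"
        by (intro outer_measure_mono[OF om]) (auto simp: Q_def)
      finally have "\<phi> (T \<inter> C) + \<phi> (Q n) + (\<Sum>i. g (i + n)) \<le> \<phi> T + (\<Sum>i. g (i + n))"
        by (rule add_right_mono)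
      then have "\<phi> (T \<inter> C) + (\<phi> (Q n) + (\<Sum>i. g (i + n))) \<le> \<phi> T + (\<Sum>i. g (i + n))"
        by (simp only: add.assoc)
      with add_left_mono[OF tail[of n]] show ?thesis
        by (rule order_trans)
    qed
    moreover have "(\<lambda>n. \<phi> T + (\<Sum>i. g (i + n))) \<longlonglongrightarrow> \<phi> T + 0"
      by (intro tendsto_add tendsto_const suminf_tail_ennreal_tendsto_0 g_fin)
    ultimately have "\<phi> (T \<inter> C) + \<phi> (T - C) \<le> \<phi> T + 0"
      by (intro LIMSEQ_le_const) auto
    then show ?thesis by simp
  qed
  then have le: "\<phi> (T \<inter> C) + \<phi> (T - C) \<le> \<phi> T" for T
    by (cases "\<phi> T < \<infinity>") (auto simp: less_top[symmetric])
  have "\<phi> T \<le> \<phi> (T \<inter> C) + \<phi> (T - C)" for T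
    using outer_measure_Un_le[OF om, of "T \<inter> C" "T - C"] by (simp add: Int_Diff_Un)
  with le show ?thesis
    unfolding caratheodory_sets_iff by (auto intro: antisym)
qed

lemma borel_measure_caratheodory_measure:
  "borel_measure (caratheodory_measure \<S> \<zeta> :: 'a::metric_space set \<Rightarrow> ennreal)"
proof -
  let ?\<psi> = "caratheodory_measure \<S> \<zeta> :: 'a set \<Rightarrow> ennreal"
  note om = outer_measure_space_caratheodory_measure[of \<S> \<zeta>]
  have sa: "sigma_algebra UNIV (caratheodory_sets ?\<psi>)"
    using measure_space_caratheodory[OF om] by (simp add: measure_space_def)
  have "C \<in> caratheodory_sets ?\<psi>" if "closed C" for C
  proof (rule metric_outer_measure_closed[OF om _ that])
    show "?\<psi> R + ?\<psi> T \<le> ?\<psi> (R \<union> T)"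
      if "0 < r" "\<And>x y. x \<in> R \<Longrightarrow> y \<in> T \<Longrightarrow> r \<le> dist x y" for R T r
      using that by (rule caratheodory_measure_separated)
  qed
  then have "Collect closed \<subseteq> caratheodory_sets ?\<psi>"
    by blast
  then show ?thesis
    unfolding borel_measure_def borel_eq_closed
    using sigma_algebra.sigma_sets_subset[OF sa] by (simp add: sets_measure_of_conv)
qed

section \<open>Comparison through the Federer density\<close>

text \<open>Covers draw on all of \<open>\<S>\<close>. Outside the quotient class both values are 0
  or both infinite, and the bound holds trivially; inside it, a quotient at most \<open>t\<close>
  rules out \<open>\<zeta> S = 0\<close>, where the quotient is infinite.\<close>

lemma quotient_le_imp:
  assumes "S \<in> \<S>" "0 < t" "S \<in> quotient_class \<mu> \<S> \<zeta> \<Longrightarrow> quotient_function \<mu> \<zeta> S \<le> ennreal t"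
  shows "\<mu> S \<le> ennreal t * \<zeta> S"
proof (cases "S \<in> quotient_class \<mu> \<S> \<zeta> \<and> \<zeta> S \<noteq> \<infinity>")
  case True
  with assms have le: "quotient_function \<mu> \<zeta> S \<le> ennreal t"
    by blast
  then have "\<zeta> S \<noteq> 0"
    by (auto simp: quotient_function_def top_unique)
  with True le have "\<mu> S / \<zeta> S \<le> ennreal t"
    by (simp add: quotient_function_def)
  then have "\<mu> S / \<zeta> S * \<zeta> S \<le> ennreal t * \<zeta> S"
    by (rule mult_right_mono) simp
  moreover have "\<mu> S / \<zeta> S * \<zeta> S = \<mu> S"
    using True \<open>\<zeta> S \<noteq> 0\<close> by (simp add: ennreal_divide_times ennreal_divide_self less_top)
  ultimately show ?thesis by simp
next
  case False
  with assms(1,2) show ?thesis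
    by (auto simp: quotient_class_def ennreal_mult_top)
qed

text \<open>An infinite gauge has quotient 0 and is excluded, and a zero gauge forces
  \<open>\<mu> S\<close> to be nonzero within the quotient class. Positivity later yields
  countability of disjoint families.\<close>

lemma less_quotient_imp:
  assumes "S \<in> quotient_class \<mu> \<S> \<zeta>" "0 < t" "ennreal t < quotient_function \<mu> \<zeta> S"
  shows "ennreal t * \<zeta> S \<le> \<mu> S" "0 < \<mu> S"
proof -
  have "ennreal t * \<zeta> S \<le> \<mu> S \<and> 0 < \<mu> S"
  proof (cases "\<zeta> S = 0")
    case True
    with assms(1) show ?thesis
      by (auto simp: quotient_class_def zero_less_iff_neq_zero)
  next
    case False
    with assms(3) have fin: "\<zeta> S \<noteq> \<infinity>" and less: "ennreal t < \<mu> S / \<zeta> S"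
      by (auto simp: quotient_function_def split: if_splits)
    from less have "ennreal t * \<zeta> S \<le> \<mu> S / \<zeta> S * \<zeta> S"
      by (intro mult_right_mono) auto
    moreover have "\<mu> S / \<zeta> S * \<zeta> S = \<mu> S"
      using fin False by (simp add: ennreal_divide_times ennreal_divide_self less_top)
    moreover have "\<mu> S \<noteq> 0"
      using less by auto
    ultimately show ?thesis
      by (simp add: zero_less_iff_neq_zero)
  qed
  then show "ennreal t * \<zeta> S \<le> \<mu> S" "0 < \<mu> S" by auto
qed

lemma measure_le_if_federer_density_less:
  fixes \<mu> :: "'a::metric_space set \<Rightarrow> ennreal"
  assumes om: "outer_measure_space UNIV \<mu>" and reg: "regular_measure \<mu>" and t: "0 < t"
    and dens: "\<And>x. x \<in> B \<Longrightarrow> federer_density \<mu> \<S> \<zeta> x < ennreal t"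
  shows "\<mu> B \<le> ennreal t * caratheodory_measure \<S> \<zeta> B"
proof -
  let ?Q = "quotient_class \<mu> \<S> \<zeta>" and ?\<psi> = "caratheodory_measure \<S> \<zeta>"
  \<comment> \<open>\<open>R n\<close> gathers the points where the quotient bound holds at all
    scales below \<open>1 / (n + 1)\<close>. These sets exhaust \<open>B\<close> but need not be
    measurable, hence the use of regularity.\<close>
  define R where "R n = {x \<in> B. \<forall>S\<in>?Q. x \<in> S \<and> ediam S < ennreal (1 / real (Suc n)) \<longrightarrow>
      quotient_function \<mu> \<zeta> S \<le> ennreal t}" for n
  have "incseq R"
  proof (rule incseq_SucI, rule subsetI)
    fix n x assume x: "x \<in> R n"
    have "ennreal (1 / real (Suc (Suc n))) \<le> ennreal (1 / real (Suc n))"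
      by (intro ennreal_leI) (simp add: field_simps)
    then have "ediam S < ennreal (1 / real (Suc n))" if "ediam S < ennreal (1 / real (Suc (Suc n)))"
      for S :: "'a set"
      using that by (rule less_le_trans[rotated])
    with x show "x \<in> R (Suc n)"
      unfolding R_def by blast
  qed
  have "B = (\<Union>n. R n)"
  proof
    show "B \<subseteq> (\<Union>n. R n)"
    proof
      fix x assume x: "x \<in> B"
      obtain \<epsilon> :: real where \<epsilon>: "\<epsilon> > 0"
        "(SUP S\<in>{S \<in> ?Q. x \<in> S \<and> ediam S < ennreal \<epsilon>}. quotient_function \<mu> \<zeta> S) < ennreal t"
        using dens[OF x] unfolding federer_density_def INF_less_iff by auto
      obtain n where n: "1 / real (Suc n) < \<epsilon>"
        using reals_Archimedean[OF \<epsilon>(1)] by (auto simp: inverse_eq_divide)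
      have "quotient_function \<mu> \<zeta> S \<le> ennreal t"
        if "S \<in> ?Q" "x \<in> S" "ediam S < ennreal (1 / real (Suc n))" for S
      proof -
        have "ediam S < ennreal \<epsilon>"
          using that(3) ennreal_leI[OF less_imp_le[OF n]] by (rule less_le_trans)
        with that have "quotient_function \<mu> \<zeta> S \<le>
            (SUP S\<in>{S \<in> ?Q. x \<in> S \<and> ediam S < ennreal \<epsilon>}. quotient_function \<mu> \<zeta> S)"
          by (intro SUP_upper) auto
        with \<epsilon>(2) show ?thesis by simp
      qed
      with x have "x \<in> R n"
        by (auto simp: R_def)
      then show "x \<in> (\<Union>n. R n)" by blast
    qed
  qed (auto simp: R_def)
  have "\<mu> (R n) \<le> ennreal t * ?\<psi> B" for n
  proof -
    \<comment> \<open>Covers allow diameters equal to \<open>?\<delta>\<close>, whereas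
      \<open>R n\<close> speaks of diameters strictly below \<open>1 / (n + 1)\<close>; the next
      reciprocal leaves the room.\<close>
    let ?\<delta> = "1 / real (Suc (Suc n))"
    have "\<mu> (R n) / ennreal t \<le> caratheodory_premeasure \<S> \<zeta> ?\<delta> (R n)"
    proof (rule caratheodory_premeasure_greatest)
      fix J :: "nat set" and E
      assume E: "\<And>j. j \<in> J \<Longrightarrow> E j \<in> \<S>" "\<And>j. j \<in> J \<Longrightarrow> ediam (E j) \<le> ennreal ?\<delta>"
        "R n \<subseteq> (\<Union>j\<in>J. E j)"
      have "\<mu> (R n) \<le> \<mu> (\<Union>j. if j \<in> J then R n \<inter> E j else {})"
        using E(3) by (intro outer_measure_mono[OF om]) auto
      also have "\<dots> \<le> (\<Sum>j. \<mu> (if j \<in> J then R n \<inter> E j else {}))"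
        by (rule outer_measure_UN_le[OF om])
      also have "\<dots> \<le> (\<Sum>j. ennreal t * (if j \<in> J then \<zeta> (E j) else 0))"
      proof (intro suminf_le)
        fix j
        show "\<mu> (if j \<in> J then R n \<inter> E j else {}) \<le> ennreal t * (if j \<in> J then \<zeta> (E j) else 0)"
        proof (cases "j \<in> J \<and> R n \<inter> E j \<noteq> {}")
          case True
          \<comment> \<open>A point of \<open>R n\<close> in \<open>E j\<close> passes its quotient
            bound to \<open>E j\<close>; sets missing \<open>R n\<close> contribute nothing.\<close>
          then obtain x where x: "x \<in> R n" "x \<in> E j" "j \<in> J"
            by blast
          have "ennreal ?\<delta> < ennreal (1 / real (Suc n))"
            by (intro ennreal_lessI) (auto simp: field_simps)
          with E(2)[OF x(3)] have "ediam (E j) < ennreal (1 / real (Suc n))"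
            by (rule le_less_trans)
          with x have "\<mu> (E j) \<le> ennreal t * \<zeta> (E j)"
            using E(1)[OF x(3)] t by (intro quotient_le_imp) (auto simp: R_def)
          with True show ?thesis
            using outer_measure_mono[OF om, of "R n \<inter> E j" "E j"] by (auto intro: order_trans)
        next
          case False
          then have "(if j \<in> J then R n \<inter> E j else {}) = {}" by auto
          then show ?thesis
            by (simp only: outer_measure_empty_set[OF om]) simp
        qed
      qed auto
      also have "\<dots> = ennreal t * (\<Sum>j. if j \<in> J then \<zeta> (E j) else 0)"
        by (rule ennreal_suminf_cmult)
      finally show "\<mu> (R n) / ennreal t \<le> (\<Sum>j. if j \<in> J then \<zeta> (E j) else 0)"
        using t by (intro divide_le_posI_ennreal) auto
    qed
    also have "\<dots> \<le> ?\<psi> (R n)"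
      by (rule caratheodory_premeasure_le_measure) simp
    also have "\<dots> \<le> ?\<psi> B"
      by (intro outer_measure_mono[OF outer_measure_space_caratheodory_measure]) (auto simp: R_def)
    finally have "ennreal t * (\<mu> (R n) / ennreal t) \<le> ennreal t * ?\<psi> B"
      by (rule mult_left_mono) simp
    moreover have "ennreal t * (\<mu> (R n) / ennreal t) = \<mu> (R n)"
      using t by (simp add: ennreal_times_divide ennreal_mult_divide_eq mult.commute[of "ennreal t"])
    ultimately show ?thesis
      by simp
  qed
  then show ?thesis
    using regular_outer_measure_incseq[OF om reg \<open>incseq R\<close>] \<open>B = (\<Union>n. R n)\<close>
    by (simp add: SUP_least)
qed

text \<open>Induction over the Borel sets as generated by the closed ones. Approximating from both
  sides makes the claim stable under complements, and measuring only inside \<open>V\<close>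
  provides the finiteness for continuity from above.\<close>

lemma finite_borel_regular:
  fixes M :: "'a::metric_space measure"
  assumes sub: "sets borel \<subseteq> sets M" and V: "V \<in> sets M" "emeasure M V < \<infinity>"
    and B: "B \<in> sets borel" and e: "e > (0::real)"
  shows "\<exists>C U. closed C \<and> open U \<and> C \<subseteq> B \<and> B \<subseteq> U \<and> emeasure M (V \<inter> (U - C)) < ennreal e"
proof -
  have fin: "emeasure M (V \<inter> T) \<noteq> \<infinity>" for T
    using emeasure_mono[of "V \<inter> T" V M] V by (metis Int_lower1 infinity_ennreal_def leD)
  have cl: "closed C \<Longrightarrow> C \<in> sets M" and op: "open U \<Longrightarrow> U \<in> sets M" for C U
    using sub by (auto intro: borel_closed borel_open)
  have decreasing: "\<exists>n. emeasure M (V \<inter> D n) < ennreal b"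
    if "\<And>n. D n \<in> sets M" "decseq D" "emeasure M (V \<inter> (\<Inter>n. D n)) < ennreal b" for D b
  proof -
    have "(\<lambda>n. emeasure M (V \<inter> D n)) \<longlonglongrightarrow> emeasure M (\<Inter>n. V \<inter> D n)"
      using that V fin by (intro Lim_emeasure_decseq) (auto simp: decseq_def)
    moreover have "(\<Inter>n. V \<inter> D n) = V \<inter> (\<Inter>n. D n)" by auto
    ultimately have "eventually (\<lambda>n. emeasure M (V \<inter> D n) < ennreal b) sequentially"
      using that(3) by (intro order_tendstoD(2)[of _ "emeasure M (V \<inter> (\<Inter>n. D n))"]) auto
    then show ?thesis
      by (auto simp: eventually_sequentially)
  qed
  have "B \<in> sigma_sets UNIV (Collect closed)"
    using B by (simp add: borel_eq_closed sets_measure_of_conv)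
  then show ?thesis
    using e
  proof (induction arbitrary: e rule: sigma_sets.induct)
    case (Basic C)
    then have C: "closed C" by simp
    \<comment> \<open>A closed set is the intersection of its shrinking open neighbourhoods.\<close>
    define U where "U n = (\<Union>x\<in>C. ball x (1 / real (Suc n)))" for n
    have U: "open (U n)" "C \<subseteq> U n" for n
      by (auto simp: U_def)
    have "\<exists>n. emeasure M (V \<inter> (U n - C)) < ennreal e"
    proof (rule decreasing)
      show "U n - C \<in> sets M" for n
        using cl[OF C] op[OF U(1)] by auto
      show "decseq (\<lambda>n. U n - C)"
      proof (rule decseq_SucI)
        fix n
        have "ball x (1 / real (Suc (Suc n))) \<subseteq> ball x (1 / real (Suc n))" for x :: 'a
          by (intro subset_ball) (simp add: field_simps)
        then show "U (Suc n) - C \<subseteq> U n - C"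
          unfolding U_def by blast
      qed
      have "x \<in> C" if "\<And>n. x \<in> U n" for x
      proof -
        have "\<exists>y\<in>C. dist y x < \<epsilon>" if \<epsilon>: "\<epsilon> > 0" for \<epsilon>
        proof -
          obtain n where n: "1 / real (Suc n) < \<epsilon>"
            using reals_Archimedean[OF \<epsilon>] by (auto simp: inverse_eq_divide)
          obtain y where "y \<in> C" "dist y x < 1 / real (Suc n)"
            using \<open>\<And>n. x \<in> U n\<close>[of n] by (auto simp: U_def)
          with n show ?thesis
            by (meson less_trans)
        qed
        then show ?thesis
          using C by (metis closure_approachable closure_closed)
      qed
      then have "V \<inter> (\<Inter>n. U n - C) = {}" by blast
      then show "emeasure M (V \<inter> (\<Inter>n. U n - C)) < ennreal e"
        using Basic.prems by simp
    qed
    then show ?case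
      using C U by blast
  next
    case Empty
    then show ?case
      by (intro exI[of _ "{}"]) auto
  next
    case (Compl B)
    then obtain C U where CU: "closed C" "open U" "C \<subseteq> B" "B \<subseteq> U" "emeasure M (V \<inter> (U - C)) < ennreal e"
      using Compl.IH[OF Compl.prems] by blast
    \<comment> \<open>The approximating sets exchange roles under complement, with the same
      difference set.\<close>
    have "(- C) - (- U) = U - C" by auto
    with CU show ?case
      by (intro exI[of _ "- U"] exI[of _ "- C"]) (auto simp: open_closed)
  next
    case (Union B)
    \<comment> \<open>The errors sum to \<open>e/2\<close>. The other half pays for replacing the
      union of the \<open>C i\<close>, not closed in general, by a finite union.\<close>
    define b where "b i = e/2 * (1/2) ^ Suc i" for i
    have "\<forall>i. \<exists>C U. closed C \<and> open U \<and> C \<subseteq> B i \<and> B i \<subseteq> U \<and> emeasure M (V \<inter> (U - C)) < ennreal (b i)"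
      using Union.prems by (intro allI Union.IH) (simp add: b_def)
    then obtain C where "\<forall>i. \<exists>U. closed (C i) \<and> open U \<and> C i \<subseteq> B i \<and> B i \<subseteq> U \<and>
        emeasure M (V \<inter> (U - C i)) < ennreal (b i)"
      unfolding choice_iff by blast
    then obtain U where CU: "\<And>i. closed (C i)" "\<And>i. open (U i)" "\<And>i. C i \<subseteq> B i" "\<And>i. B i \<subseteq> U i"
        "\<And>i. emeasure M (V \<inter> (U i - C i)) < ennreal (b i)"
      unfolding choice_iff by blast
    have "\<exists>n. emeasure M (V \<inter> ((\<Union>i. U i) - (\<Union>i<n. C i))) < ennreal e"
    proof (rule decreasing)
      show "(\<Union>i. U i) - (\<Union>i<n. C i) \<in> sets M" for n
        using cl CU(1) op CU(2) by auto
      show "decseq (\<lambda>n. (\<Union>i. U i) - (\<Union>i<n. C i))"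
        by (rule decseq_SucI) (auto simp: less_Suc_eq)
      have "(\<Inter>n. (\<Union>i. U i) - (\<Union>i<n. C i)) \<subseteq> (\<Union>i. U i - C i)"
        by (auto; metis lessI lessThan_iff)
      then have "emeasure M (V \<inter> (\<Inter>n. (\<Union>i. U i) - (\<Union>i<n. C i))) \<le> emeasure M (\<Union>i. V \<inter> (U i - C i))"
        using V cl CU(1) op CU(2) by (intro emeasure_mono) auto
      also have "\<dots> \<le> (\<Sum>i. emeasure M (V \<inter> (U i - C i)))"
        using V cl CU(1) op CU(2) by (intro emeasure_subadditive_countably) auto
      also have "\<dots> \<le> (\<Sum>i. ennreal (b i))"
        using CU(5) by (intro suminf_le) (auto intro: less_imp_le)
      also have "\<dots> = ennreal (e/2)"
        using sums_mult[OF power_half_series, of "e/2"] Union.prems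
        by (intro suminf_ennreal_eq) (auto simp: b_def)
      also have "\<dots> < ennreal e"
        using Union.prems by (intro ennreal_lessI) auto
      finally show "emeasure M (V \<inter> (\<Inter>n. (\<Union>i. U i) - (\<Union>i<n. C i))) < ennreal e" .
    qed
    then obtain n where "emeasure M (V \<inter> ((\<Union>i. U i) - (\<Union>i<n. C i))) < ennreal e" ..
    moreover have "closed (\<Union>i<n. C i)" "open (\<Union>i. U i)"
      using CU(1,2) by auto
    moreover have "(\<Union>i<n. C i) \<subseteq> (\<Union>i. B i)" "(\<Union>i. B i) \<subseteq> (\<Union>i. U i)"
      using CU(3,4) by blast+
    ultimately show ?case
      by (intro exI conjI)
  qed
qed

section \<open>Vitali coverings and the lower bound on open sets\<close>

lemma federer_density_covers_finely:
  fixes \<mu> :: "'a::metric_space set \<Rightarrow> ennreal"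
  assumes dens: "ennreal t < federer_density \<mu> \<S> \<zeta> x" and U: "open U" "x \<in> U" and d: "0 < d"
  obtains S where "S \<in> quotient_class \<mu> \<S> \<zeta>" "x \<in> S" "S \<subseteq> U" "ediam S \<le> ennreal d"
    "ennreal t < quotient_function \<mu> \<zeta> S"
proof -
  let ?Q = "quotient_class \<mu> \<S> \<zeta>"
  obtain r where r: "r > 0" "ball x r \<subseteq> U"
    using U by (meson open_contains_ball)
  \<comment> \<open>Diameter below \<open>r\<close> keeps a set through \<open>x\<close> inside
    \<open>U\<close>; the bound \<open>d\<close> is the requested scale.\<close>
  define \<epsilon> where "\<epsilon> = min r d"
  have "\<epsilon> > 0"
    using r d by (simp add: \<epsilon>_def)
  note dens
  also have "federer_density \<mu> \<S> \<zeta> x \<le> (SUP S\<in>{S \<in> ?Q. x \<in> S \<and> ediam S < ennreal \<epsilon>}. quotient_function \<mu> \<zeta> S)"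
    unfolding federer_density_def using \<open>\<epsilon> > 0\<close> by (intro INF_lower) auto
  finally obtain S where S: "S \<in> ?Q" "x \<in> S" "ediam S < ennreal \<epsilon>" "ennreal t < quotient_function \<mu> \<zeta> S"
    unfolding less_SUP_iff by blast
  have "S \<subseteq> U"
  proof
    fix y assume "y \<in> S"
    then have "ennreal (dist x y) < ennreal \<epsilon>"
      using S(2,3) dist_le_ediam by (meson le_less_trans)
    then have "dist x y < r"
      using \<open>\<epsilon> > 0\<close> by (simp add: ennreal_less_iff \<epsilon>_def)
    with r(2) show "y \<in> U" by auto
  qed
  moreover have "ediam S \<le> ennreal d"
    by (intro order_trans[OF less_imp_le[OF S(3)] ennreal_leI]) (simp add: \<epsilon>_def)
  ultimately show ?thesis
    using that S by blast
qed

text \<open>Finite sums are bounded by the measure of \<open>U\<close>, so the measures are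
  summable; all being nonzero, there are only countably many. The index set \<open>J\<close> may be
  finite, as in the covers that define the premeasure.\<close>

lemma disjoint_positive_enumeration:
  fixes M :: "'a measure"
  assumes H: "disjoint H" "H \<subseteq> sets M" "\<And>T. T \<in> H \<Longrightarrow> T \<subseteq> U" "\<And>T. T \<in> H \<Longrightarrow> emeasure M T > 0"
    and U: "U \<in> sets M" "emeasure M U < \<infinity>"
  obtains J :: "nat set" and E where "H = E ` J"
    "(\<Sum>j. if j \<in> J then emeasure M (E j) else 0) \<le> emeasure M U"
proof -
  have sum_le: "sum (emeasure M) K \<le> emeasure M U" if K: "finite K" "K \<subseteq> H" for K
  proof -
    have "disjoint_family_on (\<lambda>T. T) K"
      using H(1) K(2) by (auto simp: disjoint_family_on_def disjoint_def)
    then have "sum (emeasure M) K = emeasure M (\<Union>T\<in>K. T)"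
      using K H(2) by (intro sum_emeasure) auto
    also have "\<dots> \<le> emeasure M U"
      using K(2) H(3) U(1) by (intro emeasure_mono) auto
    finally show ?thesis .
  qed
  have fin: "emeasure M T < \<infinity>" if "T \<in> H" for T
    using emeasure_mono[OF H(3)[OF that] U(1)] U(2) by (rule le_less_trans)
  then have eq: "ennreal (measure M T) = emeasure M T" if "T \<in> H" for T
    using that by (intro emeasure_eq_ennreal_measure[symmetric]) (simp add: less_top)
  have "(\<lambda>T. measure M T) summable_on H"
  proof (rule nonneg_bdd_above_summable_on)
    show "bdd_above (sum (measure M) ` {F. F \<subseteq> H \<and> finite F})"
    proof (rule bdd_aboveI2)
      fix F assume F: "F \<in> {F. F \<subseteq> H \<and> finite F}"
      have "ennreal (sum (measure M) F) = (\<Sum>T\<in>F. ennreal (measure M T))"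
        by (rule sum_ennreal[symmetric]) simp
      also have "\<dots> = sum (emeasure M) F"
        using F eq by (intro sum.cong) auto
      also have "\<dots> \<le> emeasure M U"
        using F sum_le by auto
      also have "\<dots> = ennreal (measure M U)"
        using U(2) by (intro emeasure_eq_ennreal_measure) auto
      finally show "sum (measure M) F \<le> measure M U"
        by simp
    qed
  qed auto
  then have "countable {T \<in> H. measure M T \<noteq> 0}"
    by (rule summable_countable_real)
  moreover have "{T \<in> H. measure M T \<noteq> 0} = H"
    using H(4) eq by (force simp: zero_less_iff_neq_zero)
  ultimately have "countable H"
    by simp
  then obtain f :: "'a set \<Rightarrow> nat" where f: "inj_on f H"
    by (rule countableE)
  define E where "E = inv_into H f"
  have HE: "H = E ` (f ` H)" and inj: "inj_on E (f ` H)"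
    using f by (auto simp: E_def image_iff inj_on_inv_into)
  have "(\<Sum>j. if j \<in> f ` H then emeasure M (E j) else 0) \<le> emeasure M U"
  proof (rule suminf_le_const)
    fix n
    have "(\<Sum>j<n. if j \<in> f ` H then emeasure M (E j) else 0) = (\<Sum>j\<in>{..<n} \<inter> f ` H. emeasure M (E j))"
      by (simp add: sum.inter_restrict)
    also have "\<dots> = sum (emeasure M) (E ` ({..<n} \<inter> f ` H))"
      using inj by (subst sum.reindex) (auto intro: inj_on_subset)
    also have "\<dots> \<le> emeasure M U"
      using HE by (intro sum_le) auto
    finally show "(\<Sum>j<n. if j \<in> f ` H then emeasure M (E j) else 0) \<le> emeasure M U" .
  qed auto
  with HE that show ?thesis by blast
qed

text \<open>
  The Vitali selection \<open>H\<close> need not cover \<open>B\<close>, but \<open>B\<close> is covered by any finitely many members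
  of \<open>H\<close> together with the enlargements of all others; the latter contribute at most \<open>\<eta>\<close> times
  the tail of a convergent series.
\<close>

lemma measure_ge_if_federer_density_greater_open:
  fixes \<mu> :: "'a::metric_space set \<Rightarrow> ennreal"
  assumes om: "outer_measure_space UNIV \<mu>" and bor: "borel_measure \<mu>"
    and closed: "\<forall>S \<in> quotient_class \<mu> \<S> \<zeta>. closed S"
    and \<tau>: "\<tau> > 1" and c: "c \<ge> 1"
    and enl: "\<forall>S \<in> quotient_class \<mu> \<S> \<zeta>. \<exists>S' \<in> \<S>. enlargement \<tau> \<mu> \<S> \<zeta> S \<subseteq> S' \<and>
              ediam S' \<le> ennreal c * ediam S \<and> \<zeta> S' \<le> ennreal \<eta> * \<zeta> S"
    and t: "0 < t" and U: "open U" "B \<subseteq> U"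
    and dens: "\<And>x. x \<in> B \<Longrightarrow> ennreal t < federer_density \<mu> \<S> \<zeta> x"
  shows "ennreal t * caratheodory_measure \<S> \<zeta> B \<le> \<mu> U"
proof (cases "\<mu> U = \<infinity>")
  \<comment> \<open>Finiteness of \<open>\<mu> U\<close> gives countability of the selection and
    convergence of the series of measures.\<close>
  case False
  let ?Q = "quotient_class \<mu> \<S> \<zeta>" and ?M = "caratheodory_restriction \<mu>"
  have sets: "T \<in> sets ?M" if "T \<in> sets borel" for T
    using that bor by (auto simp: sets_caratheodory_restriction[OF om] borel_measure_def)
  have em: "emeasure ?M T = \<mu> T" if "T \<in> sets borel" for T
    using sets[OF that] by (simp add: emeasure_caratheodory_restriction[OF om] sets_caratheodory_restriction[OF om])
  have "caratheodory_measure \<S> \<zeta> B \<le> \<mu> U / ennreal t"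
  proof (rule caratheodory_measure_leI[of 1])
    fix \<delta> :: real assume "0 < \<delta>"
    \<comment> \<open>The sets of \<open>\<S>\<close> containing the enlargements have diameter up
      to \<open>c\<close> times the original one; \<open>d\<close> makes this at most
      \<open>\<delta>\<close>.\<close>
    define d where "d = \<delta> / c"
    have d: "0 < d" "d \<le> \<delta>" "c * d = \<delta>"
      using \<open>0 < \<delta>\<close> c by (auto simp: d_def field_simps)
    define G where "G = {S \<in> ?Q. S \<subseteq> U \<and> ediam S \<le> ennreal d \<and> ennreal t < quotient_function \<mu> \<zeta> S}"
    have G: "S \<in> sets borel" "\<mu> S > 0" "ennreal t * \<zeta> S \<le> \<mu> S" "S \<in> \<S>" if "S \<in> G" for S
      using that closed less_quotient_imp[of S \<mu> \<S> \<zeta> t] t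
      by (auto simp: G_def quotient_class_def intro: borel_closed)
    obtain H where H: "H \<subseteq> G" "disjoint H"
      "\<And>S. S \<in> G \<Longrightarrow> \<exists>T\<in>H. T \<inter> S \<noteq> {} \<and> ediam S \<le> ennreal \<tau> * ediam T"
    proof (rule vitali_subfamily[of G ediam "ennreal d" \<tau>])
      show "S \<noteq> {}" if "S \<in> G" for S
        using G(2)[OF that] outer_measure_empty_set[OF om] by auto
    qed (use \<tau> in \<open>auto simp: G_def\<close>)
    obtain J :: "nat set" and E where E: "H = E ` J"
      "(\<Sum>j. if j \<in> J then emeasure ?M (E j) else 0) \<le> emeasure ?M U"
    proof (rule disjoint_positive_enumeration[of H ?M U])
      show "T \<subseteq> U" if "T \<in> H" for T
        using that H(1) by (auto simp: G_def)
      show "emeasure ?M T > 0" if "T \<in> H" for T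
        using that H(1) em G(1,2) by auto
      show "emeasure ?M U < \<infinity>"
        using False U(1) by (simp add: em less_top[symmetric])
    qed (use H U(1) G(1) sets in auto)
    have EG: "E j \<in> G" if "j \<in> J" for j
      using that H(1) E(1) by auto
    then have EQ: "E j \<in> ?Q" if "j \<in> J" for j
      using that by (auto simp: G_def)
    define m where "m j = (if j \<in> J then \<mu> (E j) else 0)" for j
    have m_eq: "m = (\<lambda>j. if j \<in> J then emeasure ?M (E j) else 0)"
      using em G(1)[OF EG] by (auto simp: m_def)
    have m_le: "suminf m \<le> \<mu> U"
      using E(2) U(1) by (simp add: m_eq em)
    then have m_fin: "suminf m < \<infinity>"
      using False by (auto simp: less_top[symmetric] top_unique)
    have "\<exists>e. \<forall>S\<in>?Q. e S \<in> \<S> \<and> enlargement \<tau> \<mu> \<S> \<zeta> S \<subseteq> e S \<and>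
        ediam (e S) \<le> ennreal c * ediam S \<and> \<zeta> (e S) \<le> ennreal \<eta> * \<zeta> S"
      using enl by (intro bchoice) blast
    then obtain e where e: "\<And>S. S \<in> ?Q \<Longrightarrow> e S \<in> \<S>" "\<And>S. S \<in> ?Q \<Longrightarrow> enlargement \<tau> \<mu> \<S> \<zeta> S \<subseteq> e S"
      "\<And>S. S \<in> ?Q \<Longrightarrow> ediam (e S) \<le> ennreal c * ediam S"
      "\<And>S. S \<in> ?Q \<Longrightarrow> \<zeta> (e S) \<le> ennreal \<eta> * \<zeta> S"
      by blast
    have "ennreal t * caratheodory_premeasure \<S> \<zeta> \<delta> B \<le> suminf m + ennreal \<eta> * (\<Sum>i. m (i + n))" for n
    proof -
      define D where "D j = (if j < n then E j else e (E j))" for j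
      have "B \<subseteq> (\<Union>j\<in>J. D j)"
      proof
        fix x assume x: "x \<in> B"
        define W where "W = (\<Union>j\<in>J \<inter> {..<n}. E j)"
        show "x \<in> (\<Union>j\<in>J. D j)"
        proof (cases "x \<in> W")
          case True
          then show ?thesis
            by (auto simp: W_def D_def)
        next
          case False
          \<comment> \<open>As a finite union of closed sets, \<open>W\<close> can be avoided by a
            small \<open>S\<close> through \<open>x\<close>. A selected set meeting \<open>S\<close>
            then has index at least \<open>n\<close>, and the one that dominates \<open>S\<close>
            has an enlargement containing \<open>S\<close>.\<close>
          have "closed W"
            unfolding W_def using closed EQ by (intro closed_UN) auto
          then have W: "open (U - W)" "x \<in> U - W"
            using U x False by (auto simp: open_Diff)
          obtain S where S: "S \<in> ?Q" "x \<in> S" "S \<subseteq> U - W" "ediam S \<le> ennreal d"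
              "ennreal t < quotient_function \<mu> \<zeta> S"
            by (rule federer_density_covers_finely[OF dens[OF x] W d(1)])
          then have "S \<in> G"
            by (auto simp: G_def)
          then obtain j where j: "j \<in> J" "E j \<inter> S \<noteq> {}" "ediam S \<le> ennreal \<tau> * ediam (E j)"
            using H(3) E(1) by blast
          have "\<not> j < n"
            using j S(3) by (auto simp: W_def)
          moreover have "x \<in> enlargement \<tau> \<mu> \<S> \<zeta> (E j)"
            using S(1,2) j(2,3) unfolding enlargement_def by blast
          ultimately show ?thesis
            using j(1) e(2)[OF EQ[OF j(1)]] by (auto simp: D_def)
        qed
      qed
      moreover have "D j \<in> \<S>" "ediam (D j) \<le> ennreal \<delta>" if "j \<in> J" for j
      proof -
        have Ed: "ediam (E j) \<le> ennreal d"
          using EG[OF that] by (simp add: G_def)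
        have "ediam (e (E j)) \<le> ennreal c * ediam (E j)"
          by (rule e(3)[OF EQ[OF that]])
        also have "\<dots> \<le> ennreal c * ennreal d"
          using Ed by (rule mult_left_mono) simp
        also have "\<dots> = ennreal \<delta>"
          using c d by (simp add: ennreal_mult[symmetric])
        finally show "ediam (D j) \<le> ennreal \<delta>"
          using Ed ennreal_leI[OF d(2)] by (auto simp: D_def intro: order_trans)
        show "D j \<in> \<S>"
          using G(4)[OF EG[OF that]] e(1)[OF EQ[OF that]] by (simp add: D_def)
      qed
      ultimately have "caratheodory_premeasure \<S> \<zeta> \<delta> B \<le> (\<Sum>j. if j \<in> J then \<zeta> (D j) else 0)"
        by (intro caratheodory_premeasure_le)
      then have "ennreal t * caratheodory_premeasure \<S> \<zeta> \<delta> B \<le>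
          ennreal t * (\<Sum>j. if j \<in> J then \<zeta> (D j) else 0)"
        by (rule mult_left_mono) simp
      also have "\<dots> = (\<Sum>j. ennreal t * (if j \<in> J then \<zeta> (D j) else 0))"
        by (rule ennreal_suminf_cmult[symmetric])
      \<comment> \<open>Members before \<open>n\<close> cost at most \<open>m j\<close>, later ones
        at most \<open>\<eta>\<close> times \<open>m j\<close>; the surplus \<open>m j\<close> in
        the latter case lets one series serve both.\<close>
      also have "\<dots> \<le> (\<Sum>j. m j + ennreal \<eta> * (if j < n then 0 else m j))"
      proof (intro suminf_le)
        fix j
        show "ennreal t * (if j \<in> J then \<zeta> (D j) else 0) \<le> m j + ennreal \<eta> * (if j < n then 0 else m j)"
        proof (cases "j \<in> J")
          case True
          have "ennreal t * \<zeta> (e (E j)) \<le> ennreal t * (ennreal \<eta> * \<zeta> (E j))"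
            using e(4)[OF EQ[OF True]] by (rule mult_left_mono) simp
          also have "\<dots> = ennreal \<eta> * (ennreal t * \<zeta> (E j))"
            by (simp add: ac_simps)
          also have "\<dots> \<le> ennreal \<eta> * \<mu> (E j)"
            using G(3)[OF EG[OF True]] by (rule mult_left_mono) simp
          finally show ?thesis
            using True G(3)[OF EG[OF True]]
            by (auto simp: D_def m_def add_increasing)
        qed simp
      qed auto
      also have "\<dots> = suminf m + (\<Sum>j. ennreal \<eta> * (if j < n then 0 else m j))"
        by (rule suminf_add[symmetric]) auto
      also have "(\<Sum>j. ennreal \<eta> * (if j < n then 0 else m j)) = ennreal \<eta> * (\<Sum>j. if j < n then 0 else m j)"
        by (rule ennreal_suminf_cmult)
      also have "(\<Sum>j. if j < n then 0 else m j) = (\<Sum>i. m (i + n))"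
        using suminf_offset[of "\<lambda>j. if j < n then 0 else m j" n] by simp
      finally show ?thesis .
    qed
    moreover have "(\<lambda>n. suminf m + ennreal \<eta> * (\<Sum>i. m (i + n))) \<longlonglongrightarrow> suminf m + ennreal \<eta> * 0"
      by (intro tendsto_add tendsto_const ennreal_tendsto_cmult suminf_tail_ennreal_tendsto_0 m_fin) simp
    ultimately have "ennreal t * caratheodory_premeasure \<S> \<zeta> \<delta> B \<le> suminf m + ennreal \<eta> * 0"
      by (intro LIMSEQ_le_const) auto
    also have "\<dots> \<le> \<mu> U"
      using m_le by simp
    finally show "caratheodory_premeasure \<S> \<zeta> \<delta> B \<le> \<mu> U / ennreal t"
      using t by (simp add: ennreal_mult_le_iff_le_divide)
  qed simp
  with t show ?thesis
    by (simp add: ennreal_mult_le_iff_le_divide)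
qed simp

text \<open>Additivity over disjoint pieces of \<open>B\<close>, each inside one covering set,
  globalises a local inequality. \<open>K\<close> carries a common part of two possibly different
  sigma-algebras; it will be the Borel sets.\<close>

lemma emeasure_le_countable_cover:
  assumes sub: "sets K \<subseteq> sets M" "sets K \<subseteq> sets N"
    and D: "countable D" "D \<subseteq> sets K" and B: "B \<in> sets K" "B \<subseteq> \<Union>D"
    and le: "\<And>P T. T \<in> D \<Longrightarrow> P \<in> sets K \<Longrightarrow> P \<subseteq> T \<Longrightarrow> P \<subseteq> B \<Longrightarrow> emeasure M P \<le> c * emeasure N P"
  shows "emeasure M B \<le> c * emeasure N B"
proof (cases "D = {}")
  case False
  define E where "E = from_nat_into D"
  have rangeE: "range E = D"
    unfolding E_def using False D(1) by (rule range_from_nat_into)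
  then have ED: "E i \<in> D" for i
    by auto
  define P where "P i = B \<inter> disjointed E i" for i
  have PK: "P i \<in> sets K" for i
    using B(1) ED D(2) unfolding P_def disjointed_def by (intro sets.Int sets.Diff sets.finite_UN) auto
  have disj: "disjoint_family P"
    using disjoint_family_disjointed[of E] unfolding P_def disjoint_family_on_def by blast
  have BP: "(\<Union>i. P i) = B"
    using B(2) rangeE UN_disjointed_eq[of E] unfolding P_def by blast
  have "emeasure M B = (\<Sum>i. emeasure M (P i))"
    using PK sub(1) disj by (subst suminf_emeasure) (auto simp: BP)
  also have "\<dots> \<le> (\<Sum>i. c * emeasure N (P i))"
  proof (rule suminf_le)
    fix i
    have "P i \<subseteq> E i" "P i \<subseteq> B"
      using disjointed_subset[of E i] by (auto simp: P_def)
    with ED PK show "emeasure M (P i) \<le> c * emeasure N (P i)"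
      by (rule le)
  qed auto
  also have "\<dots> = c * (\<Sum>i. emeasure N (P i))"
    by (rule ennreal_suminf_cmult)
  also have "(\<Sum>i. emeasure N (P i)) = emeasure N B"
    using PK sub(2) disj by (subst suminf_emeasure) (auto simp: BP)
  finally show ?thesis .
qed (use B(2) in simp)

section \<open>Null sets and limits of constants\<close>

lemma outer_measure_null_countable_cover:
  assumes om: "outer_measure_space UNIV \<phi>" and C: "countable C" "R \<subseteq> \<Union>C"
    and null: "\<And>D. D \<in> C \<Longrightarrow> \<phi> (R \<inter> D) = 0"
  shows "\<phi> R = 0"
proof (cases "C = {}")
  case False
  then have range: "range (from_nat_into C) = C"
    using C(1) by (rule range_from_nat_into)
  have "\<phi> R \<le> \<phi> (\<Union>i. R \<inter> from_nat_into C i)"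
    using C(2) range by (intro outer_measure_mono[OF om]) blast
  also have "\<dots> \<le> (\<Sum>i. \<phi> (R \<inter> from_nat_into C i))"
    by (rule outer_measure_UN_le[OF om])
  also have "\<dots> = 0"
    using null[OF from_nat_into[OF False]] by simp
  finally show ?thesis by simp
qed (use C(2) outer_measure_empty_set[OF om] in simp)

lemma ennreal_eq_0_if_le_small_multiples:
  assumes le: "\<And>t. 0 < t \<Longrightarrow> y \<le> ennreal t * z" and z: "z < \<infinity>"
  shows "y = 0"
proof -
  obtain r where r: "z = ennreal r" "0 \<le> r"
    using z by (cases z) auto
  have "y \<le> 0 + ennreal e" if "0 < e" for e :: real
  proof -
    \<comment> \<open>The denominator \<open>r + 1\<close> also serves \<open>r = 0\<close> and
      bounds the product by \<open>e\<close>.\<close>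
    have "y \<le> ennreal (e / (r + 1)) * ennreal r"
      using le[of "e / (r + 1)"] that r by simp
    also have "\<dots> = ennreal (e / (r + 1) * r)"
      using that r by (intro ennreal_mult[symmetric]) auto
    also have "\<dots> \<le> ennreal e"
      using that r by (intro ennreal_leI) (auto simp: field_simps)
    finally show ?thesis by simp
  qed
  then have "y \<le> 0"
    by (rule ennreal_le_epsilon)
  then show ?thesis by simp
qed

lemma ennreal_eq_0_if_multiples_le:
  assumes le: "\<And>t. 0 < t \<Longrightarrow> ennreal t * y \<le> z" and z: "z < \<infinity>"
  shows "y = 0"
proof (rule ennreal_eq_0_if_le_small_multiples[OF _ z])
  fix t :: real assume t: "0 < t"
  then have "ennreal t * (ennreal (1 / t) * y) \<le> ennreal t * z"
    by (intro mult_left_mono le) auto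
  moreover have "ennreal t * (ennreal (1 / t) * y) = y"
    using t by (simp add: mult.assoc[symmetric] ennreal_mult[symmetric])
  ultimately show "y \<le> ennreal t * z" by simp
qed

text \<open>As \<open>t\<close> decreases to 1 the factor tends to 1. Finite \<open>y\<close> gives
  continuity of the product; for infinite \<open>y\<close> nothing is to be shown.\<close>

lemma ennreal_le_if_le_square_multiples:
  assumes le: "\<And>t. 1 < t \<Longrightarrow> x \<le> ennreal (t\<^sup>2) * y"
  shows "x \<le> y"
proof (cases "y = \<infinity>")
  case False
  have "(\<lambda>n. (1 + 1 / real (Suc n))\<^sup>2) \<longlonglongrightarrow> (1 + 0)\<^sup>2"
    by (intro tendsto_intros LIMSEQ_Suc lim_1_over_n)
  then have "(\<lambda>n. y * ennreal ((1 + 1 / real (Suc n))\<^sup>2)) \<longlonglongrightarrow> y * ennreal ((1 + 0)\<^sup>2)"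
    using False by (intro ennreal_tendsto_cmult tendsto_ennrealI) (auto simp: less_top)
  moreover have "x \<le> y * ennreal ((1 + 1 / real (Suc n))\<^sup>2)" for n
    using le[of "1 + 1 / real (Suc n)"] by (simp add: mult.commute)
  ultimately have "x \<le> y * ennreal ((1 + 0)\<^sup>2)"
    by (intro LIMSEQ_le_const) auto
  then show ?thesis by simp
qed simp

text \<open>Inside a covering set \<open>V\<close> of finite measure, a Borel piece \<open>P\<close>
  lies in an open set of measure at most \<open>\<mu> P + e\<close>, to which the bound for open
  sets applies. The factor is moved to the other side as \<open>1 / t\<close> to fit
  \<open>emeasure_le_countable_cover\<close>.\<close>

lemma measure_ge_if_federer_density_greater:
  fixes \<mu> :: "'a::metric_space set \<Rightarrow> ennreal"
  assumes om: "outer_measure_space UNIV \<mu>" and bor: "borel_measure \<mu>"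
    and closed: "\<forall>S \<in> quotient_class \<mu> \<S> \<zeta>. closed S"
    and \<tau>: "\<tau> > 1" and c: "c \<ge> 1"
    and enl: "\<forall>S \<in> quotient_class \<mu> \<S> \<zeta>. \<exists>S' \<in> \<S>. enlargement \<tau> \<mu> \<S> \<zeta> S \<subseteq> S' \<and>
              ediam S' \<le> ennreal c * ediam S \<and> \<zeta> S' \<le> ennreal \<eta> * \<zeta> S"
    and cover: "countable C" "B \<subseteq> \<Union>C" "\<And>U. U \<in> C \<Longrightarrow> open U \<and> \<mu> U < \<infinity>"
    and t: "0 < t" and B: "B \<in> sets borel"
    and dens: "\<And>x. x \<in> B \<Longrightarrow> ennreal t < federer_density \<mu> \<S> \<zeta> x"
  shows "ennreal t * caratheodory_measure \<S> \<zeta> B \<le> \<mu> B"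
proof -
  let ?\<psi> = "caratheodory_measure \<S> \<zeta>"
  let ?M = "caratheodory_restriction \<mu>" and ?N = "caratheodory_restriction ?\<psi>"
  note om' = outer_measure_space_caratheodory_measure[of \<S> \<zeta>]
  have sub: "sets borel \<subseteq> sets ?M" "sets borel \<subseteq> sets ?N"
    using bor borel_measure_caratheodory_measure[of \<S> \<zeta>]
    by (auto simp: borel_measure_def sets_caratheodory_restriction[OF om] sets_caratheodory_restriction[OF om'])
  have em: "emeasure ?M P = \<mu> P" and em': "emeasure ?N P = ?\<psi> P" if "P \<in> sets borel" for P
    using that sub
    by (auto simp: emeasure_caratheodory_restriction[OF om] emeasure_caratheodory_restriction[OF om']
        sets_caratheodory_restriction[OF om] sets_caratheodory_restriction[OF om'])
  have "emeasure ?N B \<le> ennreal (1 / t) * emeasure ?M B"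
  proof (rule emeasure_le_countable_cover[OF sub(2,1) cover(1) _ B cover(2)])
    show "C \<subseteq> sets borel"
      using cover(3) by (auto intro: borel_open)
    fix P V assume V: "V \<in> C" and P: "P \<in> sets borel" "P \<subseteq> V" "P \<subseteq> B"
    have "ennreal t * ?\<psi> P \<le> \<mu> P + ennreal e" if e: "0 < e" for e
    proof -
      have V': "V \<in> sets ?M" "emeasure ?M V < \<infinity>" "open V"
        using cover(3)[OF V] sub(1) by (auto simp: em borel_open)
      obtain F U where U: "closed F" "open U" "F \<subseteq> P" "P \<subseteq> U" "emeasure ?M (V \<inter> (U - F)) < ennreal e"
        using finite_borel_regular[OF sub(1) V'(1,2) P(1) e] by blast
      have Vs: "V \<inter> (U - F) \<in> sets borel"
        using V'(3) U(1,2) by (intro sets.Int sets.Diff) (auto intro: borel_open borel_closed)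
      \<comment> \<open>Intersecting with \<open>V\<close> puts the excess over \<open>P\<close>
        into \<open>V \<inter> (U - F)\<close>, which has measure below \<open>e\<close>.\<close>
      have "ennreal t * ?\<psi> P \<le> \<mu> (U \<inter> V)"
        using U P V' dens
        by (intro measure_ge_if_federer_density_greater_open[OF om bor closed \<tau> c enl t]) auto
      also have "\<dots> \<le> \<mu> (P \<union> (V \<inter> (U - F)))"
        using U by (intro outer_measure_mono[OF om]) auto
      also have "\<dots> \<le> \<mu> P + \<mu> (V \<inter> (U - F))"
        by (rule outer_measure_Un_le[OF om])
      also have "\<dots> \<le> \<mu> P + ennreal e"
        using U(5) em[OF Vs] by (intro add_left_mono) auto
      finally show ?thesis .
    qed
    then have "ennreal t * ?\<psi> P \<le> \<mu> P"
      by (rule ennreal_le_epsilon)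
    then have "ennreal (1 / t) * (ennreal t * ?\<psi> P) \<le> ennreal (1 / t) * \<mu> P"
      by (rule mult_left_mono) simp
    then show "emeasure ?N P \<le> ennreal (1 / t) * emeasure ?M P"
      using t by (simp add: em em' P(1) mult.assoc[symmetric] ennreal_mult[symmetric])
  qed
  then have "ennreal t * ?\<psi> B \<le> ennreal t * (ennreal (1 / t) * \<mu> B)"
    by (intro mult_left_mono) (auto simp: em em' B)
  then show ?thesis
    using t by (simp add: mult.assoc[symmetric] ennreal_mult[symmetric])
qed

section \<open>The area formula\<close>

theorem theorem4p1:
  fixes \<mu> :: "'a::metric_space set \<Rightarrow> ennreal"
    and \<S> :: "'a set set"
    and \<zeta> :: "'a set \<Rightarrow> ennreal"
    and \<tau> :: real
    and A :: "'a set"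
  assumes "outer_measure_space UNIV \<mu>"
    and "\<S> \<noteq> {}"
    and "\<tau> > 1"
    and "A \<noteq> {}"
    and "regular_measure \<mu>" and "borel_measure \<mu>"
    and "\<forall>S \<in> quotient_class \<mu> \<S> \<zeta>. closed S"
    and "covers_finely (quotient_class \<mu> \<S> \<zeta>) A"
    and "A \<in> sets borel"
    and "\<exists>C. countable C \<and> A \<subseteq> \<Union>C \<and> (\<forall>U\<in>C. open U \<and> \<mu> U < \<infinity>)"
    and "\<exists>(c::real) (\<eta>::real). c \<ge> 1 \<and> \<eta> > 0 \<and>
          (\<forall>S \<in> quotient_class \<mu> \<S> \<zeta>. \<exists>S' \<in> \<S>.
              enlargement \<tau> \<mu> \<S> \<zeta> S \<subseteq> S' \<and>
              ediam S' \<le> ennreal c * ediam S \<and>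
              \<zeta> S' \<le> ennreal \<eta> * \<zeta> S)"
    and "sigma_finite_wrt (caratheodory_measure \<S> \<zeta>) {x \<in> A. federer_density \<mu> \<S> \<zeta> x = 0}"
    and "abs_cont_on A \<mu> (caratheodory_measure \<S> \<zeta>)"
    and "federer_density \<mu> \<S> \<zeta> \<in> borel_measurable (restrict_space borel A)"
  shows "\<forall>B. B \<in> sets borel \<and> B \<subseteq> A \<longrightarrow>
    \<mu> B = (\<integral>\<^sup>+x\<in>B. federer_density \<mu> \<S> \<zeta> x
              \<partial>caratheodory_restriction (caratheodory_measure \<S> \<zeta>))"
proof (intro allI impI)
  fix B assume "B \<in> sets borel \<and> B \<subseteq> A"
  then have B: "B \<in> sets borel" and BA: "B \<subseteq> A" by auto
  let ?F = "federer_density \<mu> \<S> \<zeta>" and ?\<psi> = "caratheodory_measure \<S> \<zeta>"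
  let ?M = "caratheodory_restriction \<mu>" and ?N = "caratheodory_restriction ?\<psi>"
  note om = assms(1) and om' = outer_measure_space_caratheodory_measure[of \<S> \<zeta>]
  note sets = sets_caratheodory_restriction[OF om] and sets' = sets_caratheodory_restriction[OF om']
  have sub: "sets borel \<subseteq> sets ?M" "sets borel \<subseteq> sets ?N"
    using assms(6) borel_measure_caratheodory_measure[of \<S> \<zeta>]
    by (auto simp: borel_measure_def sets sets')
  have em: "emeasure ?M P = \<mu> P" and em': "emeasure ?N P = ?\<psi> P" if "P \<in> sets borel" for P
    using that sub
    by (auto simp: emeasure_caratheodory_restriction[OF om] emeasure_caratheodory_restriction[OF om'] sets sets')
  obtain C where C: "countable C" "A \<subseteq> \<Union>C" "\<And>U. U \<in> C \<Longrightarrow> open U \<and> \<mu> U < \<infinity>"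
    using assms(10) by blast
  obtain c \<eta> :: real where c: "c \<ge> 1" and enl: "\<forall>S \<in> quotient_class \<mu> \<S> \<zeta>. \<exists>S' \<in> \<S>.
      enlargement \<tau> \<mu> \<S> \<zeta> S \<subseteq> S' \<and> ediam S' \<le> ennreal c * ediam S \<and> \<zeta> S' \<le> ennreal \<eta> * \<zeta> S"
    using assms(11) by blast

  \<comment> \<open>The two comparisons inside \<open>A\<close>\<close>
  have upper: "\<mu> P \<le> ennreal t * ?\<psi> P" if "0 < t" "\<And>x. x \<in> P \<Longrightarrow> ?F x < ennreal t" for P t
    using that by (rule measure_le_if_federer_density_less[OF om assms(5)])
  have lower: "ennreal t * ?\<psi> P \<le> \<mu> P"
    if "0 < t" "P \<in> sets borel" "P \<subseteq> A" "\<And>x. x \<in> P \<Longrightarrow> ennreal t < ?F x" for P t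
  proof (rule measure_ge_if_federer_density_greater[OF om assms(6,7,3) c enl C(1) _ C(3)])
    show "P \<subseteq> \<Union>C"
      using that(3) C(2) by blast
  qed (use that in auto)

  \<comment> \<open>Measurability of the Federer density is given on \<open>A\<close> only;
    extension by zero makes it a Borel function on the whole space, fit to define
    \<open>\<nu>\<close>.\<close>
  define f where "f x = ?F x * indicator A x" for x
  have f: "f \<in> borel_measurable borel"
    unfolding f_def using assms(9,14)
    by (subst borel_measurable_restrict_space_iff_ennreal[symmetric]) auto
  have f': "f \<in> borel_measurable ?N"
    using f sub(2) by (auto simp: measurable_def)
  have fF: "f x = ?F x" if "x \<in> A" for x
    using that by (simp add: f_def)
  define \<nu> where "\<nu> = density ?N f"
  have sub\<nu>: "sets borel \<subseteq> sets \<nu>"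
    using sub(2) by (simp add: \<nu>_def)
  have em\<nu>: "emeasure \<nu> P = (\<integral>\<^sup>+x\<in>P. f x \<partial>?N)" if "P \<in> sets borel" for P
    unfolding \<nu>_def using that sub(2) f' by (intro emeasure_density) auto
  have int_const: "(\<integral>\<^sup>+x. k * indicator P x \<partial>?N) = k * ?\<psi> P" if "P \<in> sets borel" for P k
    using that sub(2) em' by (subst nn_integral_cmult_indicator) auto

  \<comment> \<open>\<open>P\<close> and the sets of the \<open>\<sigma>\<close>-finite cover need
    not be measurable: \<open>upper\<close> holds for arbitrary sets, and every \<open>t > 0\<close>
    is admissible where the density vanishes.\<close>
  have zero: "\<mu> P = 0" if "P \<subseteq> {x \<in> A. ?F x = 0}" for P
  proof -
    obtain D where D: "countable D" "{x \<in> A. ?F x = 0} \<subseteq> \<Union>D" "\<And>T. T \<in> D \<Longrightarrow> ?\<psi> T < \<infinity>"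
      using assms(12) unfolding sigma_finite_wrt_def by blast
    show ?thesis
    proof (rule outer_measure_null_countable_cover[OF om D(1)])
      fix T assume T: "T \<in> D"
      show "\<mu> (P \<inter> T) = 0"
      proof (rule ennreal_eq_0_if_le_small_multiples)
        show "\<mu> (P \<inter> T) \<le> ennreal t * ?\<psi> (P \<inter> T)" if "0 < t" for t
          using \<open>P \<subseteq> _\<close> that by (intro upper) auto
        show "?\<psi> (P \<inter> T) < \<infinity>"
          using outer_measure_mono[OF om', of "P \<inter> T" T] D(3)[OF T] by auto
      qed
    qed (use that D(2) in blast)
  qed
  \<comment> \<open>Every real \<open>t\<close> is below an infinite density, while
    \<open>\<mu>\<close> is finite on each \<open>U\<close> of the cover; hence each part
    \<open>P \<inter> U\<close> is null for \<open>?\<psi>\<close>.\<close>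
  have inf: "?\<psi> P = 0" if P: "P \<in> sets borel" "P \<subseteq> {x \<in> A. ?F x = \<infinity>}" for P
  proof (rule outer_measure_null_countable_cover[OF om' C(1)])
    fix U assume U: "U \<in> C"
    show "?\<psi> (P \<inter> U) = 0"
    proof (rule ennreal_eq_0_if_multiples_le)
      show "ennreal t * ?\<psi> (P \<inter> U) \<le> \<mu> (P \<inter> U)" if "0 < t" for t
        using P C(3)[OF U] that by (intro lower) (auto intro: borel_open)
      show "\<mu> (P \<inter> U) < \<infinity>"
        using outer_measure_mono[OF om, of "P \<inter> U" U] C(3)[OF U] by auto
    qed
  qed (use P C(2) in blast)

  have level: "\<mu> P \<le> ennreal (t\<^sup>2) * emeasure \<nu> P \<and> emeasure \<nu> P \<le> ennreal (t\<^sup>2) * \<mu> P"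
    if t: "1 < t" and a: "0 < a" and P: "P \<in> sets borel" "P \<subseteq> A"
      and F: "\<And>x. x \<in> P \<Longrightarrow> ennreal a \<le> ?F x \<and> ?F x < ennreal (t * a)" for P t a
  proof
    have "\<mu> P \<le> ennreal (t * a) * ?\<psi> P"
      using t a F by (intro upper) auto
    \<comment> \<open>One factor \<open>t\<close> would do in this direction; the weaker square
      matches the reverse estimate.\<close>
    also have "\<dots> \<le> ennreal (t\<^sup>2 * a) * ?\<psi> P"
      using t a by (intro mult_right_mono ennreal_leI) (auto simp: power2_eq_square)
    also have "\<dots> = ennreal (t\<^sup>2) * (\<integral>\<^sup>+x. ennreal a * indicator P x \<partial>?N)"
      using t a by (simp add: int_const P(1) ennreal_mult mult.assoc)
    also have "\<dots> \<le> ennreal (t\<^sup>2) * emeasure \<nu> P"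
      unfolding em\<nu>[OF P(1)] using F P(2)
      by (intro mult_left_mono nn_integral_mono) (auto simp: indicator_def fF subset_iff)
    finally show "\<mu> P \<le> ennreal (t\<^sup>2) * emeasure \<nu> P" .
    \<comment> \<open>The density may equal \<open>a\<close>, but \<open>lower\<close> needs a
      strict bound; dividing by \<open>t > 1\<close> provides it and costs the second factor
      \<open>t\<close>.\<close>
    have less: "ennreal (a / t) < ?F x" if "x \<in> P" for x
    proof -
      have "ennreal (a / t) < ennreal a"
        using t a by (intro ennreal_lessI) (auto simp: field_simps)
      also have "\<dots> \<le> ?F x"
        using F[OF that] by simp
      finally show ?thesis .
    qed
    have "emeasure \<nu> P \<le> (\<integral>\<^sup>+x. ennreal (t * a) * indicator P x \<partial>?N)"
      unfolding em\<nu>[OF P(1)] using F P(2)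
      by (intro nn_integral_mono) (auto simp: indicator_def fF subset_iff intro: less_imp_le)
    also have "\<dots> = ennreal (t\<^sup>2 * (a / t)) * ?\<psi> P"
      using t by (simp add: int_const P(1) power2_eq_square)
    also have "\<dots> = ennreal (t\<^sup>2) * (ennreal (a / t) * ?\<psi> P)"
      using t a by (subst ennreal_mult) (auto simp: mult.assoc)
    also have "\<dots> \<le> ennreal (t\<^sup>2) * \<mu> P"
      using t a P less by (intro mult_left_mono lower) auto
    finally show "emeasure \<nu> P \<le> ennreal (t\<^sup>2) * \<mu> P" .
  qed

  \<comment> \<open>Decomposition into level sets\<close>
  have both: "\<mu> B \<le> ennreal (t\<^sup>2) * emeasure \<nu> B \<and> emeasure \<nu> B \<le> ennreal (t\<^sup>2) * \<mu> B"
    if t: "1 < t" for t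
  proof -
    \<comment> \<open>Integer exponents of both signs reach every positive finite value; the upper
      end is written as \<open>t\<close> times the lower one to match \<open>level\<close>.\<close>
    define L where "L n = {x \<in> A. ennreal (t powr real_of_int n) \<le> f x \<and> f x < ennreal (t * t powr real_of_int n)}"
      for n :: int
    define D where "D = insert {x \<in> A. f x = 0} (insert {x \<in> A. f x = \<infinity>} (range L))"
    have D: "countable D" "D \<subseteq> sets borel"
      using assms(9) f by (auto simp: D_def L_def)
    have BD: "B \<subseteq> \<Union>D"
    proof
      fix x assume "x \<in> B"
      then have x: "x \<in> A"
        using BA by blast
      show "x \<in> \<Union>D"
      proof (cases "f x = 0 \<or> f x = \<infinity>")
        case True
        with x show ?thesis by (auto simp: D_def)
      next
        case False
        then obtain r where r: "f x = ennreal r" "0 < r"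
          by (cases "f x") (auto simp: ennreal_eq_0_iff)
        \<comment> \<open>The floor of the logarithm places \<open>r\<close> between two consecutive
          powers of \<open>t\<close>.\<close>
        define n where "n = \<lfloor>log t r\<rfloor>"
        have "t powr real_of_int n \<le> t powr log t r"
          using t by (intro powr_mono) (auto simp: n_def)
        moreover have "t powr log t r < t powr (real_of_int n + 1)"
          using t by (intro powr_less_mono) (auto simp: n_def)
        ultimately have "t powr real_of_int n \<le> r" "r < t * t powr real_of_int n"
          using t r by (auto simp: powr_add mult.commute)
        then have "x \<in> L n"
          using x r by (auto simp: L_def intro: ennreal_leI ennreal_lessI)
        then show ?thesis by (auto simp: D_def)
      qed
    qed
    have piece: "\<mu> P \<le> ennreal (t\<^sup>2) * emeasure \<nu> P \<and> emeasure \<nu> P \<le> ennreal (t\<^sup>2) * \<mu> P"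
      if T: "T \<in> D" and P: "P \<in> sets borel" "P \<subseteq> T" for P T
    proof -
      consider "T = {x \<in> A. f x = 0}" | "T = {x \<in> A. f x = \<infinity>}" | n where "T = L n"
        using T by (auto simp: D_def)
      then show ?thesis
      proof cases
        case 1
        have "\<mu> P = 0"
          using P(2) 1 by (intro zero) (auto simp: fF subset_iff)
        moreover have "(\<integral>\<^sup>+x\<in>P. f x \<partial>?N) = (\<integral>\<^sup>+x. 0 \<partial>?N)"
          using P(2) 1 by (intro nn_integral_cong) (auto simp: indicator_def)
        then have "emeasure \<nu> P = 0"
          using em\<nu>[OF P(1)] by simp
        ultimately show ?thesis by simp
      next
        case 2
        have \<psi>: "?\<psi> P = 0"
          using P 2 by (intro inf) (auto simp: fF subset_iff)
        then have "\<mu> P = 0"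
          using assms(13) P(2) 2 by (auto simp: abs_cont_on_def)
        moreover have "P \<in> null_sets ?N"
          using P(1) sub(2) em' \<psi> by auto
        then have "emeasure \<nu> P = 0"
          unfolding em\<nu>[OF P(1)] by (rule nn_integral_null_set)
        ultimately show ?thesis by simp
      next
        case 3
        show ?thesis
        proof (rule level[OF t _ P(1)])
          show "P \<subseteq> A"
            using P(2) 3 by (auto simp: L_def)
          show "ennreal (t powr real_of_int n) \<le> ?F x \<and> ?F x < ennreal (t * t powr real_of_int n)"
            if "x \<in> P" for x
            using that P(2) 3 by (auto simp: L_def fF dest!: subsetD)
        qed (use t in simp)
      qed
    qed
    have "emeasure ?M B \<le> ennreal (t\<^sup>2) * emeasure \<nu> B"
      by (rule emeasure_le_countable_cover[OF sub(1) sub\<nu> D B BD]) (use piece em in auto)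
    moreover have "emeasure \<nu> B \<le> ennreal (t\<^sup>2) * emeasure ?M B"
      by (rule emeasure_le_countable_cover[OF sub\<nu> sub(1) D B BD]) (use piece em in auto)
    ultimately show ?thesis
      by (simp add: em[OF B])
  qed

  \<comment> \<open>Passage to the limit in \<open>t\<close>\<close>
  have "\<mu> B = emeasure \<nu> B"
  proof (rule antisym)
    show "\<mu> B \<le> emeasure \<nu> B"
      by (rule ennreal_le_if_le_square_multiples) (use both in blast)
    show "emeasure \<nu> B \<le> \<mu> B"
      by (rule ennreal_le_if_le_square_multiples) (use both in blast)
  qed
  also have "\<dots> = (\<integral>\<^sup>+x\<in>B. ?F x \<partial>?N)"
    unfolding em\<nu>[OF B] using BA by (intro nn_integral_cong) (auto simp: indicator_def f_def)
  finally show "\<mu> B = (\<integral>\<^sup>+x\<in>B. ?F x \<partial>?N)" .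
qed

end
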